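(* Let $f^-,f^+\in C^1(\mathbb{R}^n,\mathbb{R}^n)$ and let $x_0\in\mathbb{R}^n$ be a switched equilibrium for the vector fields $f^+$ and $f^-$, i.e. there exists $\lambda_0\in[0,1]$ such that $$\lambda_0 f^-(x_0)+(1-\lambda_0)f^+(x_0)=0.$$ Assume that the two systems $\dot x=f^-(x)-f^-(x_0)$ and $\dot x=f^+(x)-f^+(x_0)$ admit a common quadratic Lyapunov function $V\in C^2(\mathbb{R}^n,\mathbb{R})$, $V(x)=(x-x_0)^TP(x-x_0)$ with $P$ a symmetric $n\times n$ matrix, that satisfies, for some fixed constant $\alpha>0$ and all $x\in\mathbb{R}^n$, $$V'(x)\left(f^-(x)-f^-(x_0)\right)\le-\alpha\|x-x_0\|^2,\qquad V'(x)\left(f^+(x)-f^+(x_0)\right)\le-\alpha\|x-x_0\|^2 .$$ Then the switching signal $$\sigma(x)=\mathrm{sign}\left\langle x-x_0,\left[V''(x_0)f^-(x_0)\right]^T\right\rangle$$ makes $x_0$ a quadratically globally stable switched equilibrium of the switched system $\dot x=f^{\sigma}(x)$, $x\in\mathbb{R}^n$, $\sigma\in\{-1,1\}$.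
   Context: Here $V'(x)$ is the derivative (row gradient) of $V$ and $V''(x_0)$ is its Hessian matrix; $\|\cdot\|$ is the Euclidean norm and $\langle\cdot,\cdot\rangle$ the Euclidean inner product of two vectors of $\mathbb{R}^n$ (the transpose only changes how the vector $V''(x_0)f^-(x_0)$ is written). As a Lyapunov function, $V$ is positive for $x\ne x_0$, i.e. $P$ is positive definite. The superscripts $-$ and $+$ correspond to the values $\sigma=-1$ and $\sigma=1$: the closed-loop system is $\dot x=f^-(x)$ where $\sigma(x)<0$ and $\dot x=f^+(x)$ where $\sigma(x)>0$. Solutions are understood in the sense of Filippov: absolutely continuous $x(t)$ with $\dot x(t)\in K(x(t))$ for almost every $t$, where $K(x)=\{f^-(x)\}$ if $\sigma(x)<0$, $K(x)=\{f^+(x)\}$ if $\sigma(x)>0$, and $K(x)=\{\lambda f^-(x)+(1-\lambda)f^+(x):\lambda\in[0,1]\}$ if $\sigma(x)=0$. Quadratically globally stable (standard meaning): $x_0$ is a globally asymptotically stable stationary point of the closed-loop system in the Filippov sense, and this is certified by a quadratic Lyapunov function $U(x)=(x-x_0)^TQ(x-x_0)$, $Q$ symmetric positive definite, with $U'(x)\xi\le-\varepsilon\|x-x_0\|^2$ for some $\varepsilon>0$, all $x\ne x_0$ and all $\xi\in K(x)$.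
   Formalization: Added: if f^-(x_0)=0 then f^+(x_0)=0 (i.e. λ_0 can be chosen below 1). Otherwise σ≡0 and the claim fails, e.g. n=1, x_0=0, f^-(x)=-x, f^+(x)=1-x, V=x^2, where ξ=1/2 lies in K(1/2) and U'ξ>0. *)

theory Defs
  imports "HOL-Analysis.Analysis"
begin

section \<open>Smoothness and second derivatives\<close>

definition C1 :: "('a::real_normed_vector \<Rightarrow> 'b::real_normed_vector) \<Rightarrow> bool" where
  "C1 f \<longleftrightarrow> (\<exists>f' :: 'a \<Rightarrow> 'a \<Rightarrow>\<^sub>L 'b.
     (\<forall>x. (f has_derivative blinfun_apply (f' x)) (at x)) \<and> continuous_on UNIV f')"

definition C2 :: "('a::real_normed_vector \<Rightarrow> 'b::real_normed_vector) \<Rightarrow> bool" where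
  "C2 f \<longleftrightarrow> (\<exists>f' :: 'a \<Rightarrow> 'a \<Rightarrow>\<^sub>L 'b.
     (\<forall>x. (f has_derivative blinfun_apply (f' x)) (at x)) \<and> C1 f')"

definition gradient :: "(real^'n \<Rightarrow> real) \<Rightarrow> real^'n \<Rightarrow> real^'n" where
  "gradient V x = (\<chi> i. frechet_derivative V (at x) (axis i 1))"

definition hessian :: "(real^'n \<Rightarrow> real) \<Rightarrow> real^'n \<Rightarrow> real^'n^'n" where
  "hessian V x = jacobian (gradient V) (at x)"

section \<open>Quadratic functions\<close>

definition sym_pos_def :: "real^'n^'n \<Rightarrow> bool" where
  "sym_pos_def P \<longleftrightarrow> transpose P = P \<and> (\<forall>v. v \<noteq> 0 \<longrightarrow> 0 < v \<bullet> (P *v v))"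

definition quadratic_at :: "real^'n \<Rightarrow> real^'n^'n \<Rightarrow> real^'n \<Rightarrow> real" where
  "quadratic_at x0 P x = (x - x0) \<bullet> (P *v (x - x0))"

section \<open>Switched systems and Filippov solutions\<close>

definition switched_equilibrium ::
  "(real^'n \<Rightarrow> real^'n) \<Rightarrow> (real^'n \<Rightarrow> real^'n) \<Rightarrow> real^'n \<Rightarrow> bool" where
  "switched_equilibrium fm fp x0 \<longleftrightarrow>
     (\<exists>l0\<in>{0..1}. l0 *\<^sub>R fm x0 + (1 - l0) *\<^sub>R fp x0 = 0)"

text \<open>
  On \<open>\<sigma> = 0\<close> the field is the whole segment between \<open>fm x\<close> and \<open>fp x\<close>. If \<open>fm x0 = 0\<close>
  and \<open>fp x0 \<noteq> 0\<close>, which \<open>l0 = 1\<close> permits above, then the signal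
  \<open>sgn ((x - x0) \<bullet> (hessian V x0 *v fm x0))\<close> vanishes identically and does not stabilise:
  with \<open>fm x = - x\<close> and \<open>fp x = 1 - x\<close> on the line, \<open>x t = 1 - exp (- t)\<close> is a solution
  that leaves \<open>x0 = 0\<close>. A theorem about this signal therefore has to exclude that case.
\<close>

definition filippov_field ::
  "(real^'n \<Rightarrow> real^'n) \<Rightarrow> (real^'n \<Rightarrow> real^'n) \<Rightarrow> (real^'n \<Rightarrow> real) \<Rightarrow> real^'n \<Rightarrow> (real^'n) set"
  where
  "filippov_field fm fp \<sigma> x =
     (if \<sigma> x < 0 then {fm x}
      else if \<sigma> x > 0 then {fp x}
      else {l *\<^sub>R fm x + (1 - l) *\<^sub>R fp x | l. l \<in> {0..1}})"

text \<open>
  Absolute continuity of a function on a compact interval (the library constant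
  \<^const>\<open>absolutely_continuous\<close> is about measures). A pair \<open>(s, t)\<close> encodes the interval from
  \<open>s\<close> to \<open>t\<close>.
\<close>

definition abs_continuous_on :: "real \<Rightarrow> real \<Rightarrow> (real \<Rightarrow> 'a::metric_space) \<Rightarrow> bool" where
  "abs_continuous_on a b x \<longleftrightarrow>
     (\<forall>\<epsilon>>0. \<exists>\<delta>>0. \<forall>I :: (real \<times> real) set.
        finite I \<and> (\<forall>(s, t)\<in>I. a \<le> s \<and> s \<le> t \<and> t \<le> b) \<and>
        pairwise (\<lambda>p q. {fst p<..<snd p} \<inter> {fst q<..<snd q} = {}) I \<and>
        (\<Sum>(s, t)\<in>I. t - s) < \<delta> \<longrightarrow>
        (\<Sum>(s, t)\<in>I. dist (x s) (x t)) < \<epsilon>)"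

text \<open>
  Solutions of \<open>x' \<in> K x\<close> starting at time 0. The time domain \<open>J\<close> may be bounded or not,
  and closed or open on the right; absolute continuity is required on its compact subintervals.
\<close>

definition inclusion_solution ::
  "(real^'n \<Rightarrow> (real^'n) set) \<Rightarrow> real set \<Rightarrow> (real \<Rightarrow> real^'n) \<Rightarrow> bool" where
  "inclusion_solution K J x \<longleftrightarrow>
     is_interval J \<and> 0 \<in> J \<and> J \<subseteq> {0..} \<and>
     (\<forall>a b. {a..b} \<subseteq> J \<longrightarrow> abs_continuous_on a b x) \<and>
     (AE t in lebesgue. t \<in> J \<longrightarrow> (\<exists>v\<in>K (x t). (x has_vector_derivative v) (at t within J)))"

section \<open>Stability\<close>

text \<open>
  The second conjunct says that every solution continues to all \<open>t \<ge> 0\<close>; since \<open>J = {0}\<close> is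
  an admissible domain, it includes that a solution exists from every initial point.
\<close>

definition globally_asymptotically_stable ::
  "(real^'n \<Rightarrow> (real^'n) set) \<Rightarrow> real^'n \<Rightarrow> bool" where
  "globally_asymptotically_stable K x0 \<longleftrightarrow>
     0 \<in> K x0 \<and>
     (\<forall>J x. inclusion_solution K J x \<longrightarrow>
        (\<exists>y. inclusion_solution K {0..} y \<and> (\<forall>t\<in>J. y t = x t))) \<and>
     (\<forall>\<epsilon>>0. \<exists>\<delta>>0. \<forall>x. inclusion_solution K {0..} x \<and> norm (x 0 - x0) < \<delta> \<longrightarrow>
        (\<forall>t\<ge>0. norm (x t - x0) < \<epsilon>)) \<and>
     (\<forall>x. inclusion_solution K {0..} x \<longrightarrow> (x \<longlongrightarrow> x0) at_top)"

definition quadratically_globally_stable ::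
  "(real^'n \<Rightarrow> (real^'n) set) \<Rightarrow> real^'n \<Rightarrow> bool" where
  "quadratically_globally_stable K x0 \<longleftrightarrow>
     globally_asymptotically_stable K x0 \<and>
     (\<exists>Q \<epsilon>. sym_pos_def Q \<and> \<epsilon> > 0 \<and>
        (\<forall>x. x \<noteq> x0 \<longrightarrow> (\<forall>\<xi>\<in>K x.
           frechet_derivative (quadratic_at x0 Q) (at x) \<xi> \<le> - \<epsilon> * (norm (x - x0))\<^sup>2)))"

end

theory Submission
  imports Defs "HOL-Complex_Analysis.Great_Picard"
begin

text \<open>
  Let \<open>w = P *v fm x0\<close>, so that the switching function has the sign of \<open>(x - x0) \<bullet> w\<close>. The
  derivative of \<open>V\<close> along \<open>fm\<close> at \<open>x\<close> is the dissipated part, at most \<open>- \<alpha> * (norm (x - x0))\<^sup>2\<close>, plus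
  \<open>2 * ((x - x0) \<bullet> w)\<close>. Since \<open>x0\<close> is a nondegenerate switched equilibrium, \<open>fp x0\<close> is a nonpositive
  multiple of \<open>fm x0\<close>, so along \<open>fp\<close> the extra term is a nonpositive multiple of the same number.
  Hence each field is used only where its extra term is not positive. On the switching surface
  both extra terms vanish, and the decay estimate passes to convex combinations. Thus \<open>V\<close> itself certifies the decay
  for every velocity that the Filippov field allows.

  What remains is Lyapunov's theorem for differential inclusions in the almost-everywhere sense
  (locale \<open>dissipative_inclusion\<close>, applied to the Filippov field). It rests on three analytic facts.

  \<^item> An absolutely continuous function whose derivative is at most \<open>c\<close> almost everywhere grows at
    most at rate \<open>c\<close> (\<open>abs_continuous_on_increment_le\<close>). Applied to \<open>V\<close> along a solution, it
    gives stability and attraction; applied to the solution itself, it makes solutions Lipschitz,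
    since they stay in a compact sublevel set of \<open>V\<close>.
  \<^item> A Lipschitz curve is differentiable almost everywhere
    (\<open>lipschitz_negligible_nondifferentiable\<close>), by a Vitali covering argument.
  \<^item> A bounded, upper semicontinuous inclusion with nonempty closed convex values has a solution from every
    initial point (\<open>differential_inclusion_exists\<close>): a limit of Euler polygons, which is
    differentiable almost everywhere by the preceding fact.

  The second conjunct of asymptotic stability includes existence. It follows by truncating the field
  radially outside a large ball, which keeps \<open>V\<close> nonincreasing, so that trajectories never feel the
  truncation. A Lipschitz solution on a bounded interval extends to the closed interval and is then
  continued by a global one.
\<close>

section \<open>Absolutely continuous curves\<close>

lemma abs_continuous_onE:
  assumes "abs_continuous_on a b f" and "e > 0"
  obtains d where "d > 0"
    and "\<And>I. finite I \<Longrightarrow> \<forall>(s, t)\<in>I. a \<le> s \<and> s \<le> t \<and> t \<le> b \<Longrightarrow>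
        pairwise (\<lambda>p q. {fst p<..<snd p} \<inter> {fst q<..<snd q} = {}) I \<Longrightarrow>
        (\<Sum>(s, t)\<in>I. t - s) < d \<Longrightarrow> (\<Sum>(s, t)\<in>I. dist (f s) (f t)) < e"
proof -
  from assms(1)[unfolded abs_continuous_on_def, THEN spec, THEN mp, OF assms(2)]
  obtain d where d: "d > 0" "\<forall>I. finite I \<and> (\<forall>(s, t)\<in>I. a \<le> s \<and> s \<le> t \<and> t \<le> b) \<and>
        pairwise (\<lambda>p q. {fst p<..<snd p} \<inter> {fst q<..<snd q} = {}) I \<and>
        (\<Sum>(s, t)\<in>I. t - s) < d \<longrightarrow> (\<Sum>(s, t)\<in>I. dist (f s) (f t)) < e"
    by (elim exE conjE)
  show thesis by (rule that[OF d(1)]) (simp add: d(2))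
qed

lemma abs_continuous_on_compose_lipschitz:
  assumes ac: "abs_continuous_on a b f"
    and lip: "\<And>s t. s \<in> {a..b} \<Longrightarrow> t \<in> {a..b} \<Longrightarrow> dist (g s) (g t) \<le> L * dist (f s) (f t)"
  shows "abs_continuous_on a b g"
  unfolding abs_continuous_on_def
proof (intro allI impI)
  fix e :: real assume "e > 0"
  define L' where "L' = max L 1"
  have L': "L' > 0" "L \<le> L'" by (auto simp: L'_def)
  have "e / L' > 0" using \<open>e > 0\<close> L' by simp
  with ac obtain d where "d > 0" and d:
    "\<And>I. finite I \<Longrightarrow> \<forall>(s, t)\<in>I. a \<le> s \<and> s \<le> t \<and> t \<le> b \<Longrightarrow>
        pairwise (\<lambda>p q. {fst p<..<snd p} \<inter> {fst q<..<snd q} = {}) I \<Longrightarrow>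
        (\<Sum>(s, t)\<in>I. t - s) < d \<Longrightarrow> (\<Sum>(s, t)\<in>I. dist (f s) (f t)) < e / L'"
    using abs_continuous_onE by blast
  show "\<exists>d>0. \<forall>I :: (real \<times> real) set. finite I \<and> (\<forall>(s, t)\<in>I. a \<le> s \<and> s \<le> t \<and> t \<le> b) \<and>
        pairwise (\<lambda>p q. {fst p<..<snd p} \<inter> {fst q<..<snd q} = {}) I \<and>
        (\<Sum>(s, t)\<in>I. t - s) < d \<longrightarrow> (\<Sum>(s, t)\<in>I. dist (g s) (g t)) < e"
  proof (intro exI[of _ d] conjI allI impI \<open>d > 0\<close>)
    fix I :: "(real \<times> real) set"
    assume I: "finite I \<and> (\<forall>(s, t)\<in>I. a \<le> s \<and> s \<le> t \<and> t \<le> b) \<and>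
        pairwise (\<lambda>p q. {fst p<..<snd p} \<inter> {fst q<..<snd q} = {}) I \<and> (\<Sum>(s, t)\<in>I. t - s) < d"
    have "(\<Sum>(s, t)\<in>I. dist (g s) (g t)) \<le> (\<Sum>(s, t)\<in>I. L' * dist (f s) (f t))"
    proof (rule sum_mono, clarify)
      fix s t assume "(s, t) \<in> I"
      with I have "s \<in> {a..b}" "t \<in> {a..b}" by auto
      then have "dist (g s) (g t) \<le> L * dist (f s) (f t)" by (rule lip)
      also have "\<dots> \<le> L' * dist (f s) (f t)" using L' by (simp add: mult_right_mono)
      finally show "dist (g s) (g t) \<le> L' * dist (f s) (f t)" .
    qed
    also have "\<dots> = L' * (\<Sum>(s, t)\<in>I. dist (f s) (f t))"
      by (simp add: sum_distrib_left case_prod_unfold)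
    also have "\<dots> < e" using d[of I] I L' by (simp add: field_simps)
    finally show "(\<Sum>(s, t)\<in>I. dist (g s) (g t)) < e" .
  qed
qed

lemma lipschitz_imp_abs_continuous_on:
  assumes "L-lipschitz_on {a..b} f"
  shows "abs_continuous_on a b f"
proof (rule abs_continuous_on_compose_lipschitz)
  show "abs_continuous_on a b (\<lambda>t. t)"
    unfolding abs_continuous_on_def
  proof (intro allI impI)
    fix e :: real assume "e > 0"
    have "(\<Sum>(s, t)\<in>I. dist s t) = (\<Sum>(s, t)\<in>I. t - s)"
      if "\<forall>(s, t)\<in>I. a \<le> s \<and> s \<le> t \<and> t \<le> b" for I :: "(real \<times> real) set"
      using that by (intro sum.cong) (auto simp: dist_real_def)
    then show "\<exists>d>0. \<forall>I :: (real \<times> real) set. finite I \<and> (\<forall>(s, t)\<in>I. a \<le> s \<and> s \<le> t \<and> t \<le> b) \<and>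
        pairwise (\<lambda>p q. {fst p<..<snd p} \<inter> {fst q<..<snd q} = {}) I \<and>
        (\<Sum>(s, t)\<in>I. t - s) < d \<longrightarrow> (\<Sum>(s, t)\<in>I. dist s t) < e"
      using \<open>e > 0\<close> by (intro exI[of _ e]) auto
  qed
  show "dist (f s) (f t) \<le> L * dist s t" if "s \<in> {a..b}" "t \<in> {a..b}" for s t
    using assms that by (rule lipschitz_onD)
qed

lemma abs_continuous_on_imp_continuous_on:
  assumes "abs_continuous_on a b f"
  shows "continuous_on {a..b} f"
  unfolding continuous_on_iff
proof (intro ballI allI impI)
  fix x and e :: real assume x: "x \<in> {a..b}" and "e > 0"
  from assms this(2) obtain d where "d > 0" and d:
    "\<And>I. finite I \<Longrightarrow> \<forall>(s, t)\<in>I. a \<le> s \<and> s \<le> t \<and> t \<le> b \<Longrightarrow>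
        pairwise (\<lambda>p q. {fst p<..<snd p} \<inter> {fst q<..<snd q} = {}) I \<Longrightarrow>
        (\<Sum>(s, t)\<in>I. t - s) < d \<Longrightarrow> (\<Sum>(s, t)\<in>I. dist (f s) (f t)) < e"
    using abs_continuous_onE by blast
  show "\<exists>d>0. \<forall>x'\<in>{a..b}. dist x' x < d \<longrightarrow> dist (f x') (f x) < e"
  proof (intro exI[of _ d] conjI ballI impI \<open>d > 0\<close>)
    fix y assume y: "y \<in> {a..b}" "dist y x < d"
    have "(\<Sum>(s, t)\<in>{(min x y, max x y)}. dist (f s) (f t)) < e"
      using x y by (intro d) (auto simp: dist_real_def)
    then show "dist (f y) (f x) < e" by (auto simp: min_def max_def dist_commute split: if_splits)
  qed
qed

text \<open>
  The proof uses a tagged division fine for a suitable gauge. At a tag outside the exceptional set \<open>N\<close> the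
  gauge makes the increment over the cell at most \<open>(c + e)\<close> times its length. At tags in \<open>N\<close> the
  gauge confines cells to an open set of small measure, where absolute continuity makes the total
  variation small.
\<close>

lemma abs_continuous_on_increment_le:
  fixes \<phi> :: "real \<Rightarrow> real"
  assumes ab: "a \<le> b" and ac: "abs_continuous_on a b \<phi>" and N: "negligible N"
    and der: "\<And>t. t \<in> {a..b} - N \<Longrightarrow> \<exists>D\<le>c. (\<phi> has_real_derivative D) (at t within {a..b})"
  shows "\<phi> b - \<phi> a \<le> c * (b - a)"
proof (rule field_le_epsilon)
  fix \<epsilon>0 :: real assume "\<epsilon>0 > 0"
  define e where "e = \<epsilon>0 / (b - a + 2)"
  have e: "e > 0" "e * (b - a + 2) = \<epsilon>0" using ab \<open>\<epsilon>0 > 0\<close> by (auto simp: e_def)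
  from ac e(1) obtain d0 where "d0 > 0" and d0:
    "\<And>I. finite I \<Longrightarrow> \<forall>(s, t)\<in>I. a \<le> s \<and> s \<le> t \<and> t \<le> b \<Longrightarrow>
        pairwise (\<lambda>p q. {fst p<..<snd p} \<inter> {fst q<..<snd q} = {}) I \<Longrightarrow>
        (\<Sum>(s, t)\<in>I. t - s) < d0 \<Longrightarrow> (\<Sum>(s, t)\<in>I. dist (\<phi> s) (\<phi> t)) < e"
    using abs_continuous_onE by blast
  \<comment> \<open>The cells with tags in \<open>N\<close> must contribute little to \<open>\<phi> b - \<phi> a\<close> (hence \<open>d \<le> d0\<close>) and
    also to \<open>(c + e) * (b - a)\<close>, from which they are removed (hence \<open>C * d \<le> e\<close>).\<close>
  define C where "C = \<bar>c + e\<bar>"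
  define d where "d = min d0 (e / (C + 1))"
  have "C \<ge> 0" by (auto simp: C_def)
  have "d > 0" using \<open>d0 > 0\<close> e \<open>C \<ge> 0\<close> by (auto simp: d_def)
  have "C * d \<le> e"
  proof -
    have "C * d \<le> (C + 1) * (e / (C + 1))"
      using \<open>C \<ge> 0\<close> \<open>d > 0\<close> by (intro mult_mono) (auto simp: d_def)
    also have "\<dots> = e" using \<open>C \<ge> 0\<close> by simp
    finally show ?thesis .
  qed
  obtain U where U: "open U" "N \<subseteq> U" "U \<in> lmeasurable" "measure lebesgue U < d"
  proof -
    have "N \<in> lmeasurable" "measure lebesgue N = 0"
      using N negligible_imp_measurable negligible_imp_measure0 by auto
    obtain U where U: "open U" "N \<subseteq> U" "U - N \<in> lmeasurable" "emeasure lebesgue (U - N) < ennreal d"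
      using sets_lebesgue_outer_open[of N d] \<open>N \<in> lmeasurable\<close> \<open>d > 0\<close> by (metis fmeasurableD)
    have eq: "U = (U - N) \<union> N" using U(2) by blast
    have "U \<in> lmeasurable" using U(3) \<open>N \<in> lmeasurable\<close> by (subst eq) (rule fmeasurable.Un)
    moreover have "measure lebesgue U \<le> measure lebesgue (U - N) + measure lebesgue N"
      using U(3) \<open>N \<in> lmeasurable\<close> by (subst (1) eq) (intro measure_Un_le; auto)
    moreover have "measure lebesgue (U - N) < d"
      using U(3,4) \<open>d > 0\<close> by (simp add: emeasure_eq_measure2 ennreal_less_iff)
    ultimately show ?thesis using that U(1,2) \<open>measure lebesgue N = 0\<close> by simp
  qed
  have "\<exists>r>0. \<forall>s\<in>{a..b}. \<bar>s - t\<bar> < r \<longrightarrow>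
      (s \<ge> t \<longrightarrow> \<phi> s - \<phi> t \<le> (c + e) * (s - t)) \<and> (s \<le> t \<longrightarrow> \<phi> t - \<phi> s \<le> (c + e) * (t - s))"
    if t: "t \<in> {a..b} - N" for t
  proof -
    obtain D where D: "D \<le> c" "(\<phi> has_real_derivative D) (at t within {a..b})"
      using der[OF t] by blast
    from D(2)[unfolded has_field_derivative_def has_derivative_within_alt real_norm_def,
        THEN conjunct2, THEN spec, THEN mp, OF e(1)]
    obtain r where "r > 0" and r: "\<And>s. s \<in> {a..b} \<Longrightarrow> \<bar>s - t\<bar> < r \<Longrightarrow>
        \<bar>\<phi> s - \<phi> t - D * (s - t)\<bar> \<le> e * \<bar>s - t\<bar>"
      by blast
    have "(s \<ge> t \<longrightarrow> \<phi> s - \<phi> t \<le> (c + e) * (s - t)) \<and> (s \<le> t \<longrightarrow> \<phi> t - \<phi> s \<le> (c + e) * (t - s))"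
      if "s \<in> {a..b}" "\<bar>s - t\<bar> < r" for s
    proof -
      note r[OF that]
      moreover have "s \<ge> t \<Longrightarrow> D * (s - t) \<le> c * (s - t)" "s \<le> t \<Longrightarrow> D * (t - s) \<le> c * (t - s)"
        using D(1) by (auto intro!: mult_right_mono)
      ultimately show ?thesis by (auto simp: algebra_simps abs_if split: if_splits)
    qed
    with \<open>r > 0\<close> show ?thesis by blast
  qed
  then obtain r where r: "\<And>t. t \<in> {a..b} - N \<Longrightarrow> r t > 0" and
    rl: "\<And>t s. t \<in> {a..b} - N \<Longrightarrow> s \<in> {a..b} \<Longrightarrow> \<bar>s - t\<bar> < r t \<Longrightarrow> t \<le> s \<Longrightarrow>
       \<phi> s - \<phi> t \<le> (c + e) * (s - t)" and
    rr: "\<And>t s. t \<in> {a..b} - N \<Longrightarrow> s \<in> {a..b} \<Longrightarrow> \<bar>s - t\<bar> < r t \<Longrightarrow> s \<le> t \<Longrightarrow>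
       \<phi> t - \<phi> s \<le> (c + e) * (t - s)"
    by metis
  define \<gamma> where "\<gamma> t = (if t \<in> N then U else if t \<in> {a..b} then ball t (r t) else ball t 1)" for t
  have "gauge \<gamma>"
    unfolding gauge_def \<gamma>_def using U r by (auto simp: subset_iff)
  then obtain p where p: "p tagged_division_of {a..b}" "\<gamma> fine p"
    by (rule fine_division_exists_real)
  note pD = tagged_division_ofD[OF p(1)]
  have K: "K = {Inf K..Sup K} \<and> Inf K \<le> x \<and> x \<le> Sup K \<and> a \<le> Inf K \<and> Sup K \<le> b"
    if xK: "(x, K) \<in> p" for x K
  proof -
    obtain u v where uv: "K = cbox u v" using pD(4)[OF xK] by blast
    moreover have "x \<in> K" "K \<subseteq> {a..b}" using pD(2,3)[OF xK] by auto
    ultimately show ?thesis by auto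
  qed
  define B where "B = {z \<in> p. fst z \<in> N}"
  have "finite B" "B \<subseteq> p" using pD(1) by (auto simp: B_def)
  define J where "J = (\<lambda>z. (Inf (snd z), Sup (snd z))) ` B"
  \<comment> \<open>Distinct tagged cells may share a degenerate interval only if the tags agree, so that
    passing to endpoints loses no cell.\<close>
  have inj: "inj_on (\<lambda>z. (Inf (snd z), Sup (snd z))) B"
  proof (rule inj_onI, clarsimp)
    fix x K y K' assume xy: "(x, K) \<in> B" "(y, K') \<in> B" "Inf K = Inf K'" "Sup K = Sup K'"
    then have p': "(x, K) \<in> p" "(y, K') \<in> p" using \<open>B \<subseteq> p\<close> by auto
    have "K = K'" using K[OF p'(1)] K[OF p'(2)] xy by simp
    moreover have "x = y"
    proof (rule ccontr)
      assume "x \<noteq> y"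
      then have "interior K \<inter> interior K' = {}" using pD(5)[OF p'] by auto
      then have "{Inf K<..<Sup K} = {}"
        using K[OF p'(1)] \<open>K = K'\<close> by (metis Int_absorb interior_atLeastAtMost_real)
      with K[OF p'(1)] K[OF p'(2)] xy \<open>x \<noteq> y\<close> show False by (auto simp: not_less)
    qed
    ultimately show "x = y \<and> K = K'" by simp
  qed
  have intr: "interior K = {Inf K<..<Sup K}" if "(x, K) \<in> p" for x K
    using K[OF that] by (metis interior_atLeastAtMost_real)
  have Jpair: "pairwise (\<lambda>p q. {fst p<..<snd p} \<inter> {fst q<..<snd q} = {}) J"
  proof (rule pairwiseI)
    fix u v assume uv: "u \<in> J" "v \<in> J" "u \<noteq> v"
    from uv(1) obtain x K where x: "(x, K) \<in> p" "u = (Inf K, Sup K)"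
      by (auto simp: J_def B_def)
    from uv(2) obtain y K' where y: "(y, K') \<in> p" "v = (Inf K', Sup K')"
      by (auto simp: J_def B_def)
    note p' = x(1) y(1) and eq = x(2) y(2)
    have "(x, K) \<noteq> (y, K')" using uv(3) eq by auto
    from pD(5)[OF p' this] show "{fst u<..<snd u} \<inter> {fst v<..<snd v} = {}"
      using intr[OF p'(1)] intr[OF p'(2)] eq by simp
  qed
  have "finite J" using \<open>finite B\<close> by (simp add: J_def)
  have Jord: "\<forall>(s, t)\<in>J. a \<le> s \<and> s \<le> t \<and> t \<le> b"
    using K \<open>B \<subseteq> p\<close> by (fastforce simp: J_def)
  have JU: "{fst z<..<snd z} \<subseteq> U" if "z \<in> J" for z
  proof -
    from that obtain x K where xK: "(x, K) \<in> p" "x \<in> N" "z = (Inf K, Sup K)"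
      by (auto simp: J_def B_def)
    then have "K \<subseteq> U" using fineD[OF p(2) xK(1)] by (simp add: \<gamma>_def)
    with xK intr[OF xK(1)] show ?thesis using interior_subset by fastforce
  qed
  have Jsum: "(\<Sum>(s, t)\<in>J. t - s) < d"
  proof -
    have "(\<Sum>(s, t)\<in>J. t - s) = (\<Sum>z\<in>J. measure lebesgue {fst z<..<snd z})"
      using Jord by (intro sum.cong) auto
    also have "\<dots> = measure lebesgue (\<Union>z\<in>J. {fst z<..<snd z})"
      using Jpair \<open>finite J\<close> by (intro measure_UNION'[symmetric]) (auto simp: disjnt_def)
    also have "\<dots> \<le> measure lebesgue U"
      using U JU by (intro measure_mono_fmeasurable) (auto intro!: sets.finite_UN \<open>finite J\<close>)
    also have "\<dots> < d" by (rule U)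
    finally show ?thesis .
  qed
  have sB: "(\<Sum>z\<in>B. Sup (snd z) - Inf (snd z)) < d"
    using Jsum unfolding J_def by (simp add: sum.reindex[OF inj] case_prod_unfold)
  have sB2: "(\<Sum>z\<in>B. \<bar>\<phi> (Sup (snd z)) - \<phi> (Inf (snd z))\<bar>) < e"
  proof -
    have "(\<Sum>(s, t)\<in>J. dist (\<phi> s) (\<phi> t)) < e"
      by (rule d0) (use Jsum Jord Jpair \<open>finite J\<close> in \<open>auto simp: d_def\<close>)
    then show ?thesis unfolding J_def
      by (simp add: sum.reindex[OF inj] case_prod_unfold dist_real_def abs_minus_commute)
  qed
  have "\<phi> b - \<phi> a = (\<Sum>z\<in>p. \<phi> (Sup (snd z)) - \<phi> (Inf (snd z)))"
    using additive_tagged_division_1[OF ab p(1), of \<phi>] by (simp add: case_prod_unfold)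
  also have "\<dots> \<le> (\<Sum>z\<in>p. (c + e) * (Sup (snd z) - Inf (snd z)) + (if z \<in> B then
      \<bar>\<phi> (Sup (snd z)) - \<phi> (Inf (snd z))\<bar> + C * (Sup (snd z) - Inf (snd z)) else 0))"
  proof (rule sum_mono)
    fix z assume z: "z \<in> p"
    obtain x K where zx: "z = (x, K)" by (cases z)
    note xK = z[unfolded zx]
    have Kz: "Inf K \<le> x" "x \<le> Sup K" "a \<le> Inf K" "Sup K \<le> b"
      using K[OF xK] by blast+
    have "Inf K \<in> {Inf K..Sup K}" "Sup K \<in> {Inf K..Sup K}" using Kz by auto
    then have inK: "Inf K \<in> K" "Sup K \<in> K" using K[OF xK] by metis+
    show "\<phi> (Sup (snd z)) - \<phi> (Inf (snd z)) \<le> (c + e) * (Sup (snd z) - Inf (snd z)) + (if z \<in> B then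
      \<bar>\<phi> (Sup (snd z)) - \<phi> (Inf (snd z))\<bar> + C * (Sup (snd z) - Inf (snd z)) else 0)"
    proof (cases "x \<in> N")
      case True
      have "- ((c + e) * (Sup K - Inf K)) \<le> C * (Sup K - Inf K)"
        unfolding minus_mult_left by (rule mult_right_mono) (use Kz in \<open>auto simp: C_def\<close>)
      then show ?thesis using z True by (auto simp: B_def zx)
    next
      case False
      have x: "x \<in> {a..b} - N" using False Kz by auto
      have "K \<subseteq> ball x (r x)" using fineD[OF p(2) z[unfolded zx]] x by (simp add: \<gamma>_def)
      with inK have "\<bar>Inf K - x\<bar> < r x" "\<bar>Sup K - x\<bar> < r x"
        by (auto simp: dist_real_def abs_minus_commute)
      then have "\<phi> (Sup K) - \<phi> x \<le> (c + e) * (Sup K - x)" "\<phi> x - \<phi> (Inf K) \<le> (c + e) * (x - Inf K)"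
        using Kz by (auto intro!: rl[OF x] rr[OF x])
      then show ?thesis using False by (simp add: B_def zx algebra_simps)
    qed
  qed
  also have "\<dots> = (c + e) * (\<Sum>z\<in>p. Sup (snd z) - Inf (snd z)) +
      (\<Sum>z\<in>B. \<bar>\<phi> (Sup (snd z)) - \<phi> (Inf (snd z))\<bar>) + C * (\<Sum>z\<in>B. Sup (snd z) - Inf (snd z))"
    using pD(1) \<open>B \<subseteq> p\<close>
    by (simp add: sum.distrib sum_distrib_left sum.If_cases Int_absorb1)
  also have "(\<Sum>z\<in>p. Sup (snd z) - Inf (snd z)) = b - a"
    using additive_tagged_division_1[OF ab p(1), of "\<lambda>x. x"] by (simp add: case_prod_unfold)
  also have "C * (\<Sum>z\<in>B. Sup (snd z) - Inf (snd z)) \<le> C * d"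
    using sB \<open>C \<ge> 0\<close> by (intro mult_left_mono) auto
  also note \<open>C * d \<le> e\<close>
  finally have "\<phi> b - \<phi> a \<le> (c + e) * (b - a) + e + e" using sB2 by linarith
  also have "\<dots> = c * (b - a) + \<epsilon>0" using e(2) by (simp add: algebra_simps)
  finally show "\<phi> b - \<phi> a \<le> c * (b - a) + \<epsilon>0" .
qed

text \<open>
  The scalar estimate, applied to the component of \<open>x\<close> in the direction of its own increment.
\<close>

lemma abs_continuous_on_norm_increment_le:
  fixes x :: "real \<Rightarrow> 'a::real_inner"
  assumes ab: "a \<le> b" and ac: "abs_continuous_on a b x" and N: "negligible N"
    and der: "\<And>t. t \<in> {a..b} - N \<Longrightarrow> \<exists>v. norm v \<le> M \<and> (x has_vector_derivative v) (at t within {a..b})"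
  shows "norm (x b - x a) \<le> M * (b - a)"
proof -
  define w where "w = x b - x a"
  have "w \<bullet> x b - w \<bullet> x a \<le> (norm w * M) * (b - a)"
  proof (rule abs_continuous_on_increment_le[OF ab _ N])
    show "abs_continuous_on a b (\<lambda>t. w \<bullet> x t)"
    proof (rule abs_continuous_on_compose_lipschitz[OF ac])
      show "dist (w \<bullet> x s) (w \<bullet> x t) \<le> norm w * dist (x s) (x t)" for s t
        using Cauchy_Schwarz_ineq2[of w "x s - x t"] by (simp add: dist_norm inner_diff_right)
    qed
    fix t assume "t \<in> {a..b} - N"
    then obtain v where v: "norm v \<le> M" "(x has_vector_derivative v) (at t within {a..b})"
      using der by blast
    have "((\<lambda>t. w \<bullet> x t) has_real_derivative w \<bullet> v) (at t within {a..b})"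
      unfolding has_real_derivative_iff_has_vector_derivative
      by (rule bounded_linear.has_vector_derivative[OF bounded_linear_inner_right v(2)])
    moreover have "w \<bullet> v \<le> norm w * M"
      using norm_cauchy_schwarz[of w v] mult_left_mono[OF v(1), of "norm w"] by simp
    ultimately show "\<exists>D\<le>norm w * M. ((\<lambda>t. w \<bullet> x t) has_real_derivative D) (at t within {a..b})" by blast
  qed
  then have "norm w * norm w \<le> norm w * (M * (b - a))"
    by (simp add: w_def inner_diff_right[symmetric] dot_square_norm power2_eq_square mult.assoc)
  then show ?thesis
  proof (cases "norm w = 0")
    case True
    then have "x b = x a" by (simp add: w_def)
    show ?thesis
    proof (cases "a = b")
      case False
      have "\<not> {a..b} \<subseteq> N"
        using False ab N negligible_subset[of N "{a..b}"] negligible_interval(1)[of a b] by auto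
      then obtain t where "t \<in> {a..b} - N" by blast
      then have "M \<ge> 0" using der norm_ge_zero order_trans by meson
      then show ?thesis using \<open>x b = x a\<close> ab by simp
    qed simp
  qed (simp add: w_def)
qed

section \<open>Almost everywhere differentiability of Lipschitz curves\<close>

text \<open>
  The one-dimensional form of Vitali's theorem, with intervals encoded as pairs of endpoints. Points
  are required to lie in the interior of the intervals because the sets of points with prescribed
  derivates below are then visibly Borel.
\<close>

lemma Vitali_covering_intervals:
  fixes S :: "real set" and K :: "(real \<times> real) set"
  assumes fine: "\<And>t d. t \<in> S \<Longrightarrow> d > 0 \<Longrightarrow> \<exists>(a, b)\<in>K. a < t \<and> t < b \<and> b - a < d"
    and ord: "\<And>a b. (a, b) \<in> K \<Longrightarrow> a < b"
  obtains C where "countable C" "C \<subseteq> K" "disjoint_family_on (\<lambda>(a, b). {a..b}) C"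
    "negligible (S - (\<Union>(a, b)\<in>C. {a..b}))"
proof -
  define c where "c = (\<lambda>z :: real \<times> real. (fst z + snd z) / 2)"
  define r where "r = (\<lambda>z :: real \<times> real. (snd z - fst z) / 2)"
  have cb: "cball (c z) (r z) = (\<lambda>(a, b). {a..b}) z" for z
    by (auto simp: cball_eq_atLeastAtMost c_def r_def field_simps split: prod.splits)
  obtain C where C: "countable C" "C \<subseteq> K"
     "pairwise (\<lambda>i j. disjnt (cball (c i) (r i)) (cball (c j) (r j))) C"
     "negligible (S - (\<Union>i \<in> C. cball (c i) (r i)))"
  proof (rule Vitali_covering_theorem_cballs[of K r S c])
    show "0 < r i" if "i \<in> K" for i
      using ord[of "fst i" "snd i"] that by (simp add: r_def)
    fix t d :: real assume "t \<in> S" "d > 0"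
    then obtain a b where "(a, b) \<in> K" "a < t" "t < b" "b - a < d" using fine by blast
    then show "\<exists>i. i \<in> K \<and> t \<in> cball (c i) (r i) \<and> r i < d"
      by (intro exI[of _ "(a, b)"]) (auto simp: cb, simp add: r_def)
  qed
  show ?thesis
  proof (rule that[OF C(1,2)])
    show "disjoint_family_on (\<lambda>(a, b). {a..b}) C"
      using C(3) unfolding cb disjoint_family_on_def pairwise_def disjnt_def by blast
    show "negligible (S - (\<Union>(a, b)\<in>C. {a..b}))" using C(4) unfolding cb .
  qed
qed

text \<open>
  Disjoint intervals on which \<open>f\<close> has slope at least \<open>q\<close> cover almost all of \<open>S\<close>. Their total length is
  measured by Lebesgue measure, the total increment of \<open>f\<close> on them by its Stieltjes measure; the
  comparison is between these two measures of the union.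
\<close>

lemma mono_increment_ge_measure:
  fixes f :: "real \<Rightarrow> real"
  assumes mono: "\<And>x y. x \<le> y \<Longrightarrow> f x \<le> f y" and cont: "continuous_on UNIV f"
    and "0 \<le> q" "u \<le> v" and S: "S \<in> sets lebesgue" "S \<subseteq> {u..v}"
    and fine: "\<And>t d. t \<in> S \<Longrightarrow> d > 0 \<Longrightarrow> \<exists>a b. a < t \<and> t < b \<and> b - a < d \<and> q * (b - a) \<le> f b - f a"
  shows "ennreal q * emeasure lebesgue S \<le> ennreal (f v - f u)"
proof -
  \<comment> \<open>Dropping the endpoints \<open>u\<close> and \<open>v\<close> makes room for intervals inside \<open>{u..v}\<close>.\<close>
  define K where "K = {(a, b). u \<le> a \<and> a < b \<and> b \<le> v \<and> q * (b - a) \<le> f b - f a}"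
  obtain C where C: "countable C" "C \<subseteq> K" "disjoint_family_on (\<lambda>(a, b). {a..b}) C"
    "negligible ((S - {u, v}) - (\<Union>(a, b)\<in>C. {a..b}))"
  proof (rule Vitali_covering_intervals[of "S - {u, v}" K])
    fix t d :: real assume t: "t \<in> S - {u, v}" "d > 0"
    then have "u < t" "t < v" using S(2) by force+
    then obtain a b where "a < t" "t < b" "b - a < min d (min (t - u) (v - t))" "q * (b - a) \<le> f b - f a"
      using fine[of t "min d (min (t - u) (v - t))"] t by auto
    then show "\<exists>(a, b)\<in>K. a < t \<and> t < b \<and> b - a < d"
      by (intro bexI[of _ "(a, b)"]) (auto simp: K_def)
  qed (auto simp: K_def)
  define N where "N = (\<Union>(a, b)\<in>C. {a..b})"
  let ?\<mu> = "interval_measure f"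
  have N: "N \<in> sets borel" using C(1) unfolding N_def by (intro sets.countable_UN'') auto
  then have NL: "N \<in> sets lebesgue" by (simp add: sets_completionI_sets)
  have K: "u \<le> a" "a < b" "b \<le> v" "q * (b - a) \<le> f b - f a" if "(a, b) \<in> C" for a b
    using C(2) that by (auto simp: K_def)
  have Icc: "emeasure ?\<mu> {a..b} = ennreal (f b - f a)" if "a \<le> b" for a b
    using emeasure_interval_measure_Icc[OF that mono cont] by simp
  have "emeasure lebesgue S \<le> emeasure lebesgue (N \<union> ((S - {u, v}) - N \<union> {u, v}))"
    using S(1) NL by (intro emeasure_mono sets.Un sets.Diff) auto
  also have "\<dots> = emeasure lebesgue N"
    using C(4) unfolding N_def[symmetric]
    by (intro emeasure_Un_null_set null_sets.Un) (use NL in \<open>auto simp: negligible_iff_null_sets[symmetric]\<close>)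
  also have "\<dots> = emeasure lborel N" using N NL by simp
  finally have "ennreal q * emeasure lebesgue S \<le> ennreal q * emeasure lborel N"
    by (intro mult_left_mono) auto
  also have "emeasure lborel N = (\<integral>\<^sup>+z. emeasure lborel ((\<lambda>(a, b). {a..b}) z) \<partial>count_space C)"
    unfolding N_def by (rule emeasure_UN_countable[OF _ C(1,3)]) auto
  also have "ennreal q * \<dots> = (\<integral>\<^sup>+z. ennreal q * emeasure lborel ((\<lambda>(a, b). {a..b}) z) \<partial>count_space C)"
    by (rule nn_integral_cmult[symmetric]) auto
  also have "\<dots> \<le> (\<integral>\<^sup>+z. emeasure ?\<mu> ((\<lambda>(a, b). {a..b}) z) \<partial>count_space C)"
  proof (rule nn_integral_mono, clarsimp)
    fix a b assume ab: "(a, b) \<in> C"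
    then show "ennreal q * emeasure lborel {a..b} \<le> emeasure ?\<mu> {a..b}"
      using K[OF ab] \<open>0 \<le> q\<close> by (simp add: Icc ennreal_mult'[symmetric] ennreal_leI)
  qed
  also have "\<dots> = emeasure ?\<mu> N"
    unfolding N_def by (rule emeasure_UN_countable[symmetric, OF _ C(1,3)]) auto
  also have "\<dots> \<le> emeasure ?\<mu> {u..v}"
    using K by (intro emeasure_mono) (fastforce simp: N_def)+
  also have "\<dots> = ennreal (f v - f u)" using \<open>u \<le> v\<close> by (rule Icc)
  finally show ?thesis .
qed

text \<open>
  Lebesgue's argument. Cover \<open>E\<close> by disjoint intervals of slope at most \<open>p\<close> inside an open set \<open>U\<close>
  barely larger than \<open>E\<close>. By the preceding lemma inside each of them, \<open>q\<close> times the measure of \<open>E\<close> is at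
  most the total increment, which is at most \<open>p\<close> times the measure of \<open>U\<close>. With \<open>p < q\<close>, this leaves
  \<open>E\<close> no measure.
\<close>

lemma negligible_derivate_gap:
  fixes f :: "real \<Rightarrow> real"
  assumes mono: "\<And>x y. x \<le> y \<Longrightarrow> f x \<le> f y" and cont: "continuous_on UNIV f"
    and pq: "0 < p" "p < q" and E: "E \<in> lmeasurable"
    and upper: "\<And>t d. t \<in> E \<Longrightarrow> d > 0 \<Longrightarrow> \<exists>a b. a < t \<and> t < b \<and> b - a < d \<and> q * (b - a) \<le> f b - f a"
    and lower: "\<And>t d. t \<in> E \<Longrightarrow> d > 0 \<Longrightarrow> \<exists>a b. a < t \<and> t < b \<and> b - a < d \<and> f b - f a \<le> p * (b - a)"
  shows "negligible E"
proof -
  define m where "m = measure lebesgue E"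
  have m: "emeasure lebesgue E = ennreal m" using E by (simp add: m_def emeasure_eq_measure2)
  have "m \<ge> 0" by (simp add: m_def)
  have "(q - p) * m \<le> 0"
  proof (rule field_le_epsilon)
    fix e0 :: real assume "e0 > 0"
    define e where "e = e0 / p"
    have e: "e > 0" "p * e = e0" using \<open>e0 > 0\<close> pq by (auto simp: e_def)
    obtain U where U: "open U" "E \<subseteq> U" "U - E \<in> lmeasurable" "emeasure lebesgue (U - E) < ennreal e"
      using sets_lebesgue_outer_open[OF fmeasurableD[OF E] e(1)] .
    define K where "K = {(a, b). a < b \<and> {a..b} \<subseteq> U \<and> f b - f a \<le> p * (b - a)}"
    obtain C where C: "countable C" "C \<subseteq> K" "disjoint_family_on (\<lambda>(a, b). {a..b}) C"
      "negligible (E - (\<Union>(a, b)\<in>C. {a..b}))"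
    proof (rule Vitali_covering_intervals[of E K])
      fix t d :: real assume t: "t \<in> E" "d > 0"
      then obtain r where r: "r > 0" "ball t r \<subseteq> U" using U(1,2) openE by blast
      obtain a b where ab: "a < t" "t < b" "b - a < min d r" "f b - f a \<le> p * (b - a)"
        using lower[OF t(1), of "min d r"] t(2) r(1) by auto
      have "{a..b} \<subseteq> ball t r" using ab by (auto simp: dist_real_def)
      with ab r show "\<exists>(a, b)\<in>K. a < t \<and> t < b \<and> b - a < d"
        by (intro bexI[of _ "(a, b)"]) (auto simp: K_def)
    qed (auto simp: K_def)
    define N where "N = (\<Union>(a, b)\<in>C. {a..b})"
    have N: "N \<in> sets borel" using C(1) unfolding N_def by (intro sets.countable_UN'') auto
    then have NL: "N \<in> sets lebesgue" by (simp add: sets_completionI_sets)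
    have K: "a < b" "{a..b} \<subseteq> U" "f b - f a \<le> p * (b - a)" if "(a, b) \<in> C" for a b
      using C(2) that by (auto simp: K_def)
    have EL: "E \<in> sets lebesgue" using E by blast
    let ?I = "\<lambda>(a, b). {a..b::real}"
    have EN: "E \<inter> N = (\<Union>z\<in>C. E \<inter> ?I z)" by (auto simp: N_def)
    have "emeasure lebesgue E \<le> emeasure lebesgue ((E \<inter> N) \<union> (E - N))"
      using NL EL by (intro emeasure_mono sets.Un sets.Int sets.Diff) auto
    also have "\<dots> = emeasure lebesgue (E \<inter> N)"
      using C(4) unfolding N_def[symmetric]
      by (intro emeasure_Un_null_set) (use NL EL in \<open>auto simp: negligible_iff_null_sets[symmetric]\<close>)
    also have "\<dots> = (\<integral>\<^sup>+z. emeasure lebesgue (E \<inter> ?I z) \<partial>count_space C)"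
      unfolding EN
    proof (rule emeasure_UN_countable[OF _ C(1)])
      show "E \<inter> ?I z \<in> sets lebesgue" for z using EL by (auto split: prod.splits)
      show "disjoint_family_on (\<lambda>z. E \<inter> ?I z) C"
        using C(3) unfolding disjoint_family_on_def by blast
    qed
    finally have "ennreal q * emeasure lebesgue E \<le>
        ennreal q * (\<integral>\<^sup>+z. emeasure lebesgue (E \<inter> ?I z) \<partial>count_space C)"
      by (intro mult_left_mono) auto
    also have "\<dots> = (\<integral>\<^sup>+z. ennreal q * emeasure lebesgue (E \<inter> ?I z) \<partial>count_space C)"
      by (rule nn_integral_cmult[symmetric]) auto
    also have "\<dots> \<le> (\<integral>\<^sup>+z. ennreal p * emeasure lborel (?I z) \<partial>count_space C)"
    proof (rule nn_integral_mono, clarsimp)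
      fix a b assume ab: "(a, b) \<in> C"
      have "ennreal q * emeasure lebesgue (E \<inter> {a..b}) \<le> ennreal (f b - f a)"
        using K(1)[OF ab] pq EL by (intro mono_increment_ge_measure[OF mono cont] upper) auto
      also have "\<dots> \<le> ennreal (p * (b - a))" using K(3)[OF ab] by (rule ennreal_leI)
      also have "\<dots> = ennreal p * emeasure lborel {a..b}"
        using K(1)[OF ab] pq by (simp add: ennreal_mult')
      finally show "ennreal q * emeasure lebesgue (E \<inter> {a..b}) \<le> ennreal p * emeasure lborel {a..b}" .
    qed
    also have "\<dots> = ennreal p * (\<integral>\<^sup>+z. emeasure lborel (?I z) \<partial>count_space C)"
      by (rule nn_integral_cmult) auto
    also have "(\<integral>\<^sup>+z. emeasure lborel (?I z) \<partial>count_space C) = emeasure lborel N"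
      unfolding N_def by (rule emeasure_UN_countable[symmetric, OF _ C(1,3)]) auto
    also have "\<dots> = emeasure lebesgue N" using N NL by simp
    also have "\<dots> \<le> emeasure lebesgue ((U - E) \<union> E)"
      using K(2) U(1) EL by (intro emeasure_mono) (auto simp: N_def)
    also have "\<dots> \<le> emeasure lebesgue (U - E) + emeasure lebesgue E"
      using U(1) EL by (intro emeasure_subadditive) auto
    also have "\<dots> \<le> ennreal e + ennreal m"
      using U(4) by (intro add_mono) (auto simp: m)
    finally have "ennreal (q * m) \<le> ennreal (p * (e + m))"
      using pq \<open>m \<ge> 0\<close> e
      by (simp add: m mult_left_mono ennreal_mult ennreal_plus[symmetric] del: ennreal_plus)
    then have "q * m \<le> p * (e + m)" using pq \<open>m \<ge> 0\<close> e by (subst (asm) ennreal_le_iff) auto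
    then show "(q - p) * m \<le> 0 + e0" using e(2) by (simp add: algebra_simps)
  qed
  then have "m = 0" using pq \<open>m \<ge> 0\<close> by (simp add: mult_le_0_iff)
  then show ?thesis using E by (simp add: negligible_iff_measure m_def)
qed

text \<open>
  The derivative is the supremum of all lower bounds for slopes of short intervals around \<open>t\<close>;
  of any two rational numbers above it, the larger one is an upper bound for these slopes. Difference
  quotients at \<open>t\<close> itself are limits of slopes of intervals with \<open>t\<close> in the interior.
\<close>

lemma differentiable_if_no_derivate_gap:
  fixes f :: "real \<Rightarrow> real"
  assumes mono: "\<And>x y. x \<le> y \<Longrightarrow> f x \<le> f y" and cont: "continuous_on UNIV f"
    and lip: "\<And>x y. x \<le> y \<Longrightarrow> f y - f x \<le> L * (y - x)"
    and nogap: "\<And>p q. p \<in> \<rat> \<Longrightarrow> q \<in> \<rat> \<Longrightarrow> 0 < p \<Longrightarrow> p < q \<Longrightarrow>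
      (\<exists>d>0. \<forall>a b. a < t \<and> t < b \<and> b - a < d \<longrightarrow> f b - f a \<le> q * (b - a)) \<or>
      (\<exists>d>0. \<forall>a b. a < t \<and> t < b \<and> b - a < d \<longrightarrow> p * (b - a) \<le> f b - f a)"
  shows "f differentiable (at t)"
proof -
  define A where "A = {p. \<exists>d>0. \<forall>a b. a < t \<and> t < b \<and> b - a < d \<longrightarrow> p * (b - a) \<le> f b - f a}"
  have "0 \<in> A" using mono by (auto simp: A_def intro!: exI[of _ 1])
  have "p \<le> L" if "p \<in> A" for p
  proof -
    from that obtain d where d: "d > 0" "\<And>a b. a < t \<Longrightarrow> t < b \<Longrightarrow> b - a < d \<Longrightarrow> p * (b - a) \<le> f b - f a"
      by (auto simp: A_def)
    define e where "e = d / 3"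
    have e: "e > 0" "t + e - (t - e) < d" using d(1) by (auto simp: e_def)
    have "p * (t + e - (t - e)) \<le> f (t + e) - f (t - e)" using e by (intro d(2)) auto
    also have "\<dots> \<le> L * (t + e - (t - e))" using e by (intro lip) auto
    finally show ?thesis using e(1) by simp
  qed
  then have bdd: "bdd_above A" by (auto simp: bdd_above_def)
  define D where "D = Sup A"
  have "D \<ge> 0" using \<open>0 \<in> A\<close> bdd by (auto simp: D_def intro: cSup_upper)
  have key: "\<exists>d>0. \<forall>a b. a < t \<and> t < b \<and> b - a < d \<longrightarrow> \<bar>f b - f a - D * (b - a)\<bar> \<le> e * (b - a)"
    if "e > 0" for e
  proof -
    obtain p0 where "p0 \<in> A" "D - e < p0"
      using less_cSupE[of "D - e" A] \<open>e > 0\<close> \<open>0 \<in> A\<close> by (auto simp: D_def)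
    then obtain d1 where d1: "d1 > 0" "\<And>a b. a < t \<Longrightarrow> t < b \<Longrightarrow> b - a < d1 \<Longrightarrow> p0 * (b - a) \<le> f b - f a"
      by (auto simp: A_def)
    obtain p where p: "p \<in> \<rat>" "D < p" "p < D + e" using Rats_dense_in_real[of D "D + e"] \<open>e > 0\<close> by auto
    obtain q where q: "q \<in> \<rat>" "p < q" "q < D + e" using Rats_dense_in_real[of p "D + e"] p by auto
    have "p \<notin> A" using p(2) cSup_upper[OF _ bdd] by (force simp: D_def)
    with nogap[OF p(1) q(1)] p q \<open>D \<ge> 0\<close> obtain d2 where
      d2: "d2 > 0" "\<And>a b. a < t \<Longrightarrow> t < b \<Longrightarrow> b - a < d2 \<Longrightarrow> f b - f a \<le> q * (b - a)"
      by (auto simp: A_def)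
    show ?thesis
    proof (intro exI[of _ "min d1 d2"] conjI allI impI)
      fix a b assume ab: "a < t \<and> t < b \<and> b - a < min d1 d2"
      have "(D - e) * (b - a) \<le> p0 * (b - a)" "q * (b - a) \<le> (D + e) * (b - a)"
        using ab \<open>D - e < p0\<close> q by (auto intro!: mult_right_mono)
      with d1(2)[of a b] d2(2)[of a b] ab show "\<bar>f b - f a - D * (b - a)\<bar> \<le> e * (b - a)"
        by (auto simp: algebra_simps abs_le_iff)
    qed (use d1 d2 in auto)
  qed
  have "isCont f t" using cont continuous_on_eq_continuous_at[OF open_UNIV, of f] by simp
  then have ft: "(f \<longlongrightarrow> f t) (at t within T)" for T
    unfolding isCont_def by (rule tendsto_within_subset[OF _ subset_UNIV])
  have "(f has_derivative (\<lambda>h. D * h)) (at t)"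
    unfolding has_derivative_at_alt real_norm_def
  proof (intro conjI allI impI)
    show "bounded_linear ((*) D)" by (rule bounded_linear_mult_right)
    fix e :: real assume "e > 0"
    from key[OF this] obtain d where "d > 0" and d: "\<And>a b. a < t \<Longrightarrow> t < b \<Longrightarrow> b - a < d \<Longrightarrow>
        \<bar>f b - f a - D * (b - a)\<bar> \<le> e * (b - a)"
      by blast
    show "\<exists>d>0. \<forall>s. \<bar>s - t\<bar> < d \<longrightarrow> \<bar>f s - f t - D * (s - t)\<bar> \<le> e * \<bar>s - t\<bar>"
    proof (intro exI[of _ d] conjI allI impI \<open>d > 0\<close>)
      fix s assume s: "\<bar>s - t\<bar> < d"
      consider "s = t" | "s > t" | "s < t" by linarith
      then show "\<bar>f s - f t - D * (s - t)\<bar> \<le> e * \<bar>s - t\<bar>"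
      proof cases
        case 2
        have "\<bar>f s - f t - D * (s - t)\<bar> \<le> e * (s - t)"
        proof (rule tendsto_le[OF trivial_limit_at_left_real])
          show "((\<lambda>a. \<bar>f s - f a - D * (s - a)\<bar>) \<longlongrightarrow> \<bar>f s - f t - D * (s - t)\<bar>) (at_left t)"
            by (intro tendsto_intros ft)
          show "((\<lambda>a. e * (s - a)) \<longlongrightarrow> e * (s - t)) (at_left t)" by (intro tendsto_intros)
          show "\<forall>\<^sub>F a in at_left t. \<bar>f s - f a - D * (s - a)\<bar> \<le> e * (s - a)"
            by (rule eventually_mono[OF eventually_at_left_real[of "s - d" t]])
               (use s 2 in \<open>auto intro!: d\<close>)
        qed
        then show ?thesis using 2 by simp
      next
        case 3
        have "\<bar>f t - f s - D * (t - s)\<bar> \<le> e * (t - s)"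
        proof (rule tendsto_le[OF trivial_limit_at_right_real])
          show "((\<lambda>b. \<bar>f b - f s - D * (b - s)\<bar>) \<longlongrightarrow> \<bar>f t - f s - D * (t - s)\<bar>) (at_right t)"
            by (intro tendsto_intros ft)
          show "((\<lambda>b. e * (b - s)) \<longlongrightarrow> e * (t - s)) (at_right t)" by (intro tendsto_intros)
          show "\<forall>\<^sub>F b in at_right t. \<bar>f b - f s - D * (b - s)\<bar> \<le> e * (b - s)"
            by (rule eventually_mono[OF eventually_at_right_real[of t "s + d"]])
               (use s 3 in \<open>auto intro!: d\<close>)
        qed
        moreover have "\<bar>f s - f t - D * (s - t)\<bar> = \<bar>f t - f s - D * (t - s)\<bar>"
          by (simp add: algebra_simps abs_if)
        ultimately show ?thesis using 3 by simp
      qed simp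
    qed
  qed
  then show ?thesis by (auto simp: differentiable_def)
qed

text \<open>
  A point of nondifferentiability has a rational gap between its lower and upper derivates, so it lies in
  one of countably many sets treated above. They are cut down to bounded pieces to have
  finite measure.
\<close>

lemma mono_lipschitz_negligible_nondifferentiable:
  fixes f :: "real \<Rightarrow> real"
  assumes mono: "\<And>x y. x \<le> y \<Longrightarrow> f x \<le> f y" and cont: "continuous_on UNIV f"
    and lip: "\<And>x y. x \<le> y \<Longrightarrow> f y - f x \<le> L * (y - x)"
  shows "negligible {t. \<not> f differentiable (at t)}"
proof -
  define G where "G q = {t. \<forall>k::nat. \<exists>a b. a < t \<and> t < b \<and> b - a < 1 / Suc k \<and> q * (b - a) < f b - f a}" for q
  define H where "H p = {t. \<forall>k::nat. \<exists>a b. a < t \<and> t < b \<and> b - a < 1 / Suc k \<and> f b - f a < p * (b - a)}" for p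
  have "G q = (\<Inter>k::nat. \<Union>(a, b)\<in>{(a, b). b - a < 1 / Suc k \<and> q * (b - a) < f b - f a}. {a<..<b})" for q
    by (auto simp: G_def, blast, force)
  then have [measurable]: "G q \<in> sets borel" for q
    by (simp only:) (intro sets.countable_INT'' borel_open open_UN ballI; force)
  have "H p = (\<Inter>k::nat. \<Union>(a, b)\<in>{(a, b). b - a < 1 / Suc k \<and> f b - f a < p * (b - a)}. {a<..<b})" for p
    by (auto simp: H_def, blast, force)
  then have [measurable]: "H q \<in> sets borel" for q
    by (simp only:) (intro sets.countable_INT'' borel_open open_UN ballI; force)
  define E where "E = (\<lambda>(p, q, n::nat). {- real n..real n} \<inter> G q \<inter> H p)"
  define I where "I = {(p :: real, q :: real, n :: nat). p \<in> \<rat> \<and> q \<in> \<rat> \<and> 0 < p \<and> p < q}"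
  have "I \<subseteq> \<rat> \<times> \<rat> \<times> UNIV" by (auto simp: I_def)
  then have "countable I" by (rule countable_subset) (intro countable_SIGMA countable_rat; simp)
  have small: "\<exists>k::nat. 1 / Suc k < d" if "d > 0" for d :: real
    using reals_Archimedean[OF that] by (simp add: inverse_eq_divide)
  have "negligible (\<Union>i\<in>I. E i)"
  proof (rule negligible_countable_Union)
    show "countable (E ` I)" using \<open>countable I\<close> by simp
    fix S assume "S \<in> E ` I"
    then obtain p q n where S: "S = E (p, q, n)" and pq: "0 < p" "p < q" by (auto simp: I_def)
    have meas: "E (p, q, n) \<in> lmeasurable"
      by (rule fmeasurableI2[of "{- real n..real n}"]) (auto simp: E_def)
    show "negligible S" unfolding S
    proof (rule negligible_derivate_gap[OF mono cont pq meas])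
      fix t d :: real assume t: "t \<in> E (p, q, n)" "d > 0"
      obtain k :: nat where "1 / Suc k < d" using small[OF t(2)] by blast
      then show "\<exists>a b. a < t \<and> t < b \<and> b - a < d \<and> q * (b - a) \<le> f b - f a"
        using t(1) unfolding E_def G_def by (auto, metis less_eq_real_def less_trans)
      from \<open>1 / Suc k < d\<close> show "\<exists>a b. a < t \<and> t < b \<and> b - a < d \<and> f b - f a \<le> p * (b - a)"
        using t(1) unfolding E_def H_def by (auto, metis less_eq_real_def less_trans)
    qed
  qed
  moreover have "{t. \<not> f differentiable (at t)} \<subseteq> (\<Union>i\<in>I. E i)"
  proof (rule subsetI, rule ccontr)
    fix t assume t: "t \<in> {t. \<not> f differentiable (at t)}" "t \<notin> (\<Union>i\<in>I. E i)"
    obtain n :: nat where n: "\<bar>t\<bar> \<le> real n" using real_arch_simple by blast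
    have "f differentiable (at t)"
    proof (rule differentiable_if_no_derivate_gap[OF mono cont lip])
      fix p q :: real assume pq: "p \<in> \<rat>" "q \<in> \<rat>" "0 < p" "p < q"
      then have "(p, q, n) \<in> I" by (simp add: I_def)
      with t(2) have "t \<notin> E (p, q, n)" by blast
      with n have "t \<notin> G q \<or> t \<notin> H p" by (auto simp: E_def)
      then show "(\<exists>d>0. \<forall>a b. a < t \<and> t < b \<and> b - a < d \<longrightarrow> f b - f a \<le> q * (b - a)) \<or>
          (\<exists>d>0. \<forall>a b. a < t \<and> t < b \<and> b - a < d \<longrightarrow> p * (b - a) \<le> f b - f a)"
      proof
        assume "t \<notin> G q"
        then obtain k :: nat where "\<forall>a b. a < t \<and> t < b \<and> b - a < 1 / Suc k \<longrightarrow> f b - f a \<le> q * (b - a)"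
          unfolding G_def mem_Collect_eq by (meson linorder_not_less)
        then show ?thesis by (intro disjI1 exI[of _ "1 / Suc k"]) auto
      next
        assume "t \<notin> H p"
        then obtain k :: nat where "\<forall>a b. a < t \<and> t < b \<and> b - a < 1 / Suc k \<longrightarrow> p * (b - a) \<le> f b - f a"
          unfolding H_def mem_Collect_eq by (meson linorder_not_less)
        then show ?thesis by (intro disjI2 exI[of _ "1 / Suc k"]) auto
      qed
    qed
    with t(1) show False by simp
  qed
  ultimately show ?thesis by (rule negligible_subset)
qed

text \<open>
  Adding \<open>L * t\<close> to an \<open>L\<close>-Lipschitz component makes it nondecreasing.
\<close>

lemma lipschitz_negligible_nondifferentiable:
  fixes x :: "real \<Rightarrow> 'a::euclidean_space"
  assumes "L-lipschitz_on UNIV x"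
  shows "negligible {t. \<not> x differentiable (at t)}"
proof -
  have "negligible {t. \<not> (\<lambda>s. x s \<bullet> i) differentiable (at t)}" if i: "i \<in> Basis" for i
  proof -
    define f where "f t = x t \<bullet> i + L * t" for t
    have l: "\<bar>x s \<bullet> i - x t \<bullet> i\<bar> \<le> L * \<bar>s - t\<bar>" for s t
      using Basis_le_norm[OF i, of "x s - x t"] lipschitz_onD[OF assms, of s t]
      by (simp add: inner_diff_left dist_norm)
    have "negligible {t. \<not> f differentiable (at t)}"
    proof (rule mono_lipschitz_negligible_nondifferentiable[where L = "2 * L"])
      show "f s \<le> f t" if "s \<le> t" for s t
        using l[of s t] that by (auto simp: f_def abs_le_iff algebra_simps)
      show "continuous_on UNIV f"
        unfolding f_def using lipschitz_on_continuous_on[OF assms] by (intro continuous_intros)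
      show "f t - f s \<le> 2 * L * (t - s)" if "s \<le> t" for s t
        using l[of t s] that by (auto simp: f_def abs_le_iff algebra_simps)
    qed
    moreover have "f differentiable (at t) \<Longrightarrow> (\<lambda>s. x s \<bullet> i) differentiable (at t)" for t
    proof -
      assume "f differentiable (at t)"
      then have "(\<lambda>s. f s - L * s) differentiable (at t)" by (intro derivative_intros)
      then show ?thesis by (simp add: f_def)
    qed
    ultimately show ?thesis by (elim negligible_subset) blast
  qed
  then have "negligible (\<Union>i\<in>Basis. {t. \<not> (\<lambda>s. x s \<bullet> i) differentiable (at t)})"
    by (intro negligible_Union) auto
  then show ?thesis
    by (rule negligible_subset) (auto simp: differentiable_componentwise_within[of x])
qed

section \<open>Existence of solutions of differential inclusions\<close>

text \<open>
  The time that a clock running up to \<open>t\<close> spends in the \<open>j\<close>-th time step of length \<open>h\<close>. With it, an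
  Euler polygon is a plain sum of velocities weighted by these times, and its mean
  velocity over any time span is a convex combination of them.
\<close>

definition cell_time :: "real \<Rightarrow> nat \<Rightarrow> real \<Rightarrow> real" where
  "cell_time h j t = max 0 (min h (t - real j * h))"

lemma sum_cell_time:
  assumes "h > 0" "t \<ge> 0"
  shows "(\<Sum>j<n. cell_time h j t) = min t (real n * h)"
  using assms by (induction n) (auto simp: cell_time_def algebra_simps min_def max_def)

lemma cell_time_mono: "s \<le> t \<Longrightarrow> cell_time h j s \<le> cell_time h j t"
  by (auto simp: cell_time_def min_def max_def)

lemma cell_time_increase:
  assumes "cell_time h j s < cell_time h j t" "h > 0"
  shows "real j * h < t" "s - h < real j * h"
  using assms by (auto simp: cell_time_def min_def max_def split: if_splits)

text \<open>
  The last property is the form in which an approximate solution remembers its differential equation: a half-space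
  that contains the velocities at all points near \<open>y s\<close> contains the mean velocity over \<open>{s..t}\<close>. The additional
  \<open>h\<close> accounts for the velocity in use at time \<open>s\<close>, chosen up to one step earlier.
\<close>

lemma Euler_polygon:
  fixes g :: "'a::euclidean_space \<Rightarrow> 'a" and \<xi> :: 'a
  assumes "h > 0" "T \<ge> 0" and M: "\<And>z. norm (g z) \<le> M"
  obtains y where "y 0 = \<xi>" "M-lipschitz_on UNIV y"
    "\<And>s t a b. 0 \<le> s \<Longrightarrow> s \<le> t \<Longrightarrow> t \<le> T \<Longrightarrow>
       (\<And>z. norm (z - y s) \<le> M * (t - s + h) \<Longrightarrow> a \<bullet> g z \<le> b) \<Longrightarrow> a \<bullet> (y t - y s) \<le> b * (t - s)"
proof -
  have "M \<ge> 0" using M norm_ge_zero order_trans by blast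
  define X where "X = rec_nat \<xi> (\<lambda>_ z. z + h *\<^sub>R g z)"
  have X: "X j = \<xi> + (\<Sum>i<j. h *\<^sub>R g (X i))" for j
    by (induction j) (auto simp: X_def)
  obtain n :: nat where n: "T \<le> real n * h"
    using reals_Archimedean3[OF \<open>h > 0\<close>] less_imp_le by blast
  define p where "p t = \<xi> + (\<Sum>j<n. cell_time h j t *\<^sub>R g (X j))" for t
  have pdiff: "p t - p s = (\<Sum>j<n. (cell_time h j t - cell_time h j s) *\<^sub>R g (X j))" for s t
    by (simp add: p_def sum_subtractf scaleR_diff_left)
  have ctsum: "(\<Sum>j<n. cell_time h j t - cell_time h j s) = t - s"
    if "0 \<le> s" "s \<le> t" "t \<le> T" for s t
    using that n \<open>h > 0\<close> by (simp add: sum_subtractf sum_cell_time)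
  have plip: "norm (p t - p s) \<le> M * (t - s)" if st: "0 \<le> s" "s \<le> t" "t \<le> T" for s t
  proof -
    have "norm (p t - p s) \<le> (\<Sum>j<n. (cell_time h j t - cell_time h j s) * M)"
      unfolding pdiff
      by (rule sum_norm_le) (auto intro!: mult_mono M simp: cell_time_mono st)
    also have "\<dots> = M * (t - s)" using ctsum[OF st] by (simp add: sum_distrib_right[symmetric])
    finally show ?thesis .
  qed
  have node: "p (real j * h) = X j" if "real j * h < T" for j
  proof -
    have "real j * h < real n * h" using that n by simp
    then have "j < n" using \<open>h > 0\<close> by simp
    have ct: "cell_time h i (real j * h) = (if i < j then h else 0)" for i
    proof (cases "i < j")
      case True
      then have "real j \<ge> real i + 1" by simp
      then have "real j * h \<ge> (real i + 1) * h" using \<open>h > 0\<close> by (intro mult_right_mono) auto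
      then show ?thesis using True \<open>h > 0\<close> by (auto simp: cell_time_def algebra_simps)
    next
      case False
      then have "real j * h \<le> real i * h" using \<open>h > 0\<close> by (intro mult_right_mono) auto
      then have "min h (real j * h - real i * h) \<le> 0" by (intro min.coboundedI2) linarith
      then show ?thesis using False by (simp add: cell_time_def max_absorb1)
    qed
    have "(\<Sum>i<n. cell_time h i (real j * h) *\<^sub>R g (X i)) = (\<Sum>i<j. h *\<^sub>R g (X i))"
      unfolding ct by (rule sum.mono_neutral_cong_right) (use \<open>j < n\<close> in auto)
    then show ?thesis by (subst X) (simp add: p_def)
  qed
  have pmean: "a \<bullet> (p t - p s) \<le> b * (t - s)"
    if st: "0 \<le> s" "s \<le> t" "t \<le> T"
      and half: "\<And>z. norm (z - p s) \<le> M * (t - s + h) \<Longrightarrow> a \<bullet> g z \<le> b" for s t a b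
  proof -
    have "a \<bullet> (p t - p s) = (\<Sum>j<n. (cell_time h j t - cell_time h j s) * (a \<bullet> g (X j)))"
      by (simp add: pdiff inner_sum_right)
    also have "\<dots> \<le> (\<Sum>j<n. (cell_time h j t - cell_time h j s) * b)"
    proof (rule sum_mono)
      fix j
      show "(cell_time h j t - cell_time h j s) * (a \<bullet> g (X j)) \<le> (cell_time h j t - cell_time h j s) * b"
      proof (cases "cell_time h j s < cell_time h j t")
        case True
        note j = cell_time_increase[OF True \<open>h > 0\<close>]
        have "p (real j * h) = X j" using j st by (intro node) simp
        moreover have "norm (p (real j * h) - p s) \<le> M * \<bar>real j * h - s\<bar>"
        proof (cases "s \<le> real j * h")
          case True
          then show ?thesis using plip[of s "real j * h"] j st by simp
        next
          case False
          then show ?thesis using plip[of "real j * h" s] j st \<open>h > 0\<close> by (simp add: norm_minus_commute)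
        qed
        moreover have "M * \<bar>real j * h - s\<bar> \<le> M * (t - s + h)"
          using j st \<open>h > 0\<close> by (intro mult_left_mono \<open>M \<ge> 0\<close>) auto
        ultimately have "a \<bullet> g (X j) \<le> b" by (intro half) simp
        then show ?thesis using True by (intro mult_left_mono) auto
      next
        case False
        then have "cell_time h j s = cell_time h j t" using cell_time_mono[OF st(2), of h j] by simp
        then show ?thesis by simp
      qed
    qed
    also have "\<dots> = b * (t - s)" using ctsum[OF st] by (simp add: sum_distrib_right[symmetric])
    finally show ?thesis .
  qed
  \<comment> \<open>Freezing the polygon outside \<open>{0..T}\<close> makes it Lipschitz on the whole line.\<close>
  define y where "y t = p (max 0 (min t T))" for t
  show ?thesis
  proof (rule that)
    have "min h (0 - real j * h) \<le> 0" for j using \<open>h > 0\<close> by (intro min.coboundedI2) simp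
    then have "p 0 = \<xi>" by (simp add: p_def cell_time_def max_absorb1)
    then show "y 0 = \<xi>" using \<open>T \<ge> 0\<close> by (simp add: y_def)
    show "M-lipschitz_on UNIV y"
    proof (rule lipschitz_on_leI)
      fix s t :: real assume "s \<le> t"
      then have "norm (y t - y s) \<le> M * (max 0 (min t T) - max 0 (min s T))"
        unfolding y_def using \<open>T \<ge> 0\<close> by (intro plip) auto
      also have "\<dots> \<le> M * (t - s)" using \<open>s \<le> t\<close> by (intro mult_left_mono \<open>M \<ge> 0\<close>) auto
      finally show "dist (y s) (y t) \<le> M * dist s t"
        using \<open>s \<le> t\<close> by (simp add: dist_norm norm_minus_commute)
    qed (rule \<open>M \<ge> 0\<close>)
    fix s t b :: real and a :: 'a
    assume st: "0 \<le> s" "s \<le> t" "t \<le> T"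
      and half: "\<And>z. norm (z - y s) \<le> M * (t - s + h) \<Longrightarrow> a \<bullet> g z \<le> b"
    have "y s = p s" "y t = p t" using st by (auto simp: y_def)
    then show "a \<bullet> (y t - y s) \<le> b * (t - s)" using pmean[OF st, of a b] half by simp
  qed
qed

text \<open>
  Diagonal selection gives convergence at rational times, and the common Lipschitz constant
  carries it to all times. The curves are divided by \<open>1 + \<bar>t\<bar>\<close> during the selection because only then
  they are bounded uniformly in time.
\<close>

lemma equi_lipschitz_convergent_subsequence:
  fixes Y :: "nat \<Rightarrow> real \<Rightarrow> 'a::euclidean_space"
  assumes lip: "\<And>n. M-lipschitz_on UNIV (Y n)" and init: "\<And>n. Y n 0 = \<xi>"
  obtains r x where "strict_mono (r :: nat \<Rightarrow> nat)" "\<And>t. (\<lambda>n. Y (r n) t) \<longlonglongrightarrow> x t" "M-lipschitz_on UNIV x"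
proof -
  have "M \<ge> 0" using lip lipschitz_on_nonneg by blast
  have bnd: "norm ((1 / (1 + \<bar>t\<bar>)) *\<^sub>R (Y n t - \<xi>)) \<le> M" for n t
  proof -
    have "norm (Y n t - \<xi>) \<le> M * \<bar>t\<bar>"
      using lipschitz_onD[OF lip[of n], of t 0] by (simp add: init dist_norm)
    also have "\<dots> \<le> M * (1 + \<bar>t\<bar>)" using \<open>M \<ge> 0\<close> by (intro mult_left_mono) auto
    finally show ?thesis by (simp add: pos_divide_le_eq)
  qed
  obtain r :: "nat \<Rightarrow> nat" where r: "strict_mono r"
    "\<And>t. t \<in> \<rat> \<Longrightarrow> \<exists>l. (\<lambda>n. (1 / (1 + \<bar>t\<bar>)) *\<^sub>R (Y (r n) t - \<xi>)) \<longlonglongrightarrow> l"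
    using function_convergent_subsequence[of \<rat> "\<lambda>n t. (1 / (1 + \<bar>t\<bar>)) *\<^sub>R (Y n t - \<xi>)" M]
      bnd countable_rat by blast
  have rat: "convergent (\<lambda>n. Y (r n) t)" if t: "t \<in> \<rat>" for t
  proof -
    obtain l where "(\<lambda>n. (1 / (1 + \<bar>t\<bar>)) *\<^sub>R (Y (r n) t - \<xi>)) \<longlonglongrightarrow> l" using r(2)[OF t] by blast
    then have "(\<lambda>n. (1 + \<bar>t\<bar>) *\<^sub>R ((1 / (1 + \<bar>t\<bar>)) *\<^sub>R (Y (r n) t - \<xi>)) + \<xi>) \<longlonglongrightarrow> (1 + \<bar>t\<bar>) *\<^sub>R l + \<xi>"
      by (intro tendsto_intros)
    moreover have "(1 + \<bar>t\<bar>) *\<^sub>R ((1 / (1 + \<bar>t\<bar>)) *\<^sub>R z) = z" for z :: 'a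
    proof -
      have "1 + \<bar>t\<bar> \<noteq> 0" using abs_ge_zero[of t] by linarith
      then show ?thesis by simp
    qed
    ultimately show ?thesis by (auto simp: convergent_def)
  qed
  have conv: "convergent (\<lambda>n. Y (r n) t)" for t
  proof -
    have "Cauchy (\<lambda>n. Y (r n) t)"
      unfolding Cauchy_def
    proof (intro allI impI)
      fix e :: real assume "e > 0"
      define d where "d = e / (3 * (M + 1))"
      have "d > 0" using \<open>e > 0\<close> \<open>M \<ge> 0\<close> by (simp add: d_def)
      have "M * d \<le> (M + 1) * d" using \<open>d > 0\<close> by (intro mult_right_mono) auto
      also have "\<dots> = e / 3" using \<open>M \<ge> 0\<close> by (simp add: d_def field_simps)
      finally have Md: "M * d \<le> e / 3" .
      obtain s where s: "s \<in> \<rat>" "t < s" "s < t + d" using Rats_dense_in_real[of t "t + d"] \<open>d > 0\<close> by auto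
      have near: "dist (Y (r n) t) (Y (r n) s) \<le> e / 3" for n
      proof -
        have "dist (Y (r n) t) (Y (r n) s) \<le> M * dist t s" by (rule lipschitz_onD[OF lip]) auto
        also have "\<dots> \<le> M * d" using s by (intro mult_left_mono \<open>M \<ge> 0\<close>) (auto simp: dist_real_def)
        finally show ?thesis using Md by simp
      qed
      have "Cauchy (\<lambda>n. Y (r n) s)" using rat[OF s(1)] by (simp add: Cauchy_convergent_iff)
      then obtain N where N: "\<And>m n. m \<ge> N \<Longrightarrow> n \<ge> N \<Longrightarrow> dist (Y (r m) s) (Y (r n) s) < e / 3"
        using \<open>e > 0\<close> unfolding Cauchy_def by (metis divide_pos_pos zero_less_numeral)
      show "\<exists>N. \<forall>m\<ge>N. \<forall>n\<ge>N. dist (Y (r m) t) (Y (r n) t) < e"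
      proof (intro exI[of _ N] allI impI)
        fix m n assume mn: "m \<ge> N" "n \<ge> N"
        have "dist (Y (r m) t) (Y (r n) t) \<le> dist (Y (r m) t) (Y (r m) s) + dist (Y (r m) s) (Y (r n) s)
            + dist (Y (r n) t) (Y (r n) s)"
          by (metis add_mono_thms_linordered_semiring(3) dist_commute dist_triangle dist_triangle_le)
        then show "dist (Y (r m) t) (Y (r n) t) < e" using near[of m] near[of n] N[OF mn] by simp
      qed
    qed
    then show ?thesis by (simp add: Cauchy_convergent_iff)
  qed
  define x where "x t = lim (\<lambda>n. Y (r n) t)" for t
  have x: "(\<lambda>n. Y (r n) t) \<longlonglongrightarrow> x t" for t
    using conv unfolding x_def by (simp add: convergent_LIMSEQ_iff)
  have "M-lipschitz_on UNIV x"
  proof (rule lipschitz_onI)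
    fix s t :: real
    show "dist (x s) (x t) \<le> M * dist s t"
      by (rule tendsto_upperbound[OF tendsto_dist[OF x x]])
         (auto intro!: always_eventually lipschitz_onD[OF lip])
  qed (rule \<open>M \<ge> 0\<close>)
  with r x show ?thesis using that by blast
qed

text \<open>
  Upper semicontinuity is stated in terms of half-spaces, which is what the proof uses: if the
  velocity \<open>v\<close> of the limit at time \<open>t\<close> were outside \<open>K (x t)\<close>, a hyperplane would separate it strictly from
  \<open>K (x t)\<close>. All velocities near \<open>x t\<close> would lie on the other side, hence so would the mean
  velocities of the Euler polygons and, in the limit, those of \<open>x\<close> shortly after \<open>t\<close>.
\<close>

theorem differential_inclusion_exists:
  fixes K :: "'a::euclidean_space \<Rightarrow> 'a set"
  assumes ne: "\<And>z. K z \<noteq> {}" and closed: "\<And>z. closed (K z)" and convex: "\<And>z. convex (K z)"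
    and bounded: "\<And>z v. v \<in> K z \<Longrightarrow> norm v \<le> M"
    and usc: "\<And>z a b. (\<And>v. v \<in> K z \<Longrightarrow> a \<bullet> v < b) \<Longrightarrow> \<exists>d>0. \<forall>w\<in>ball z d. \<forall>v\<in>K w. a \<bullet> v \<le> b"
  obtains x where "x 0 = \<xi>" "M-lipschitz_on UNIV x"
    "negligible {t. 0 \<le> t \<and> \<not> (\<exists>v\<in>K (x t). (x has_vector_derivative v) (at t))}"
proof -
  define g where "g z = (SOME v. v \<in> K z)" for z
  have g: "g z \<in> K z" for z using ne[of z] by (simp add: g_def some_in_eq)
  have "M \<ge> 0" using bounded[OF g] norm_ge_zero order_trans by blast
  \<comment> \<open>The \<open>k\<close>-th polygon has step \<open>1 / Suc k\<close> and is an approximate solution up to time \<open>k\<close>.\<close>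
  define Q where "Q k y \<longleftrightarrow> (\<forall>s t a b. 0 \<le> s \<longrightarrow> s \<le> t \<longrightarrow> t \<le> real k \<longrightarrow>
       (\<forall>z. norm (z - y s) \<le> M * (t - s + 1 / Suc k) \<longrightarrow> a \<bullet> g z \<le> b) \<longrightarrow> a \<bullet> (y t - y s) \<le> b * (t - s))"
    for k :: nat and y :: "real \<Rightarrow> 'a"
  have "\<exists>y. y 0 = \<xi> \<and> M-lipschitz_on UNIV y \<and> Q k y" for k
  proof -
    obtain y where y: "y 0 = \<xi>" "M-lipschitz_on UNIV y"
      "\<And>s t a b. 0 \<le> s \<Longrightarrow> s \<le> t \<Longrightarrow> t \<le> real k \<Longrightarrow>
       (\<And>z. norm (z - y s) \<le> M * (t - s + 1 / Suc k) \<Longrightarrow> a \<bullet> g z \<le> b) \<Longrightarrow> a \<bullet> (y t - y s) \<le> b * (t - s)"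
    proof (rule Euler_polygon[of "1 / Suc k" "real k" g M \<xi>])
      show "norm (g z) \<le> M" for z by (rule bounded[OF g])
    qed auto
    have "Q k y" unfolding Q_def by (intro allI impI y(3)) auto
    with y(1,2) show ?thesis by blast
  qed
  then obtain Y where Y0: "\<And>k. Y k 0 = \<xi>" and Ylip: "\<And>k. M-lipschitz_on UNIV (Y k)" and Q: "\<And>k. Q k (Y k)"
    by metis
  have Y: "a \<bullet> (Y k t - Y k s) \<le> b * (t - s)"
    if "0 \<le> s" "s \<le> t" "t \<le> real k"
      "\<And>z. norm (z - Y k s) \<le> M * (t - s + 1 / Suc k) \<Longrightarrow> a \<bullet> g z \<le> b" for k s t a b
    using Q[of k, unfolded Q_def, rule_format, OF that(1-3), of a b] that(4) by simp
  obtain r x where r: "strict_mono r" and x: "\<And>t. (\<lambda>n. Y (r n) t) \<longlonglongrightarrow> x t" and xlip: "M-lipschitz_on UNIV x"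
    by (rule equi_lipschitz_convergent_subsequence[where Y = Y, OF Ylip Y0]) (rule that)
  have "x 0 = \<xi>" using LIMSEQ_unique[OF x[of 0]] by (simp add: Y0)
  have inK: "v \<in> K (x t)" if "t \<ge> 0" and v: "(x has_vector_derivative v) (at t)" for t v
  proof (rule ccontr)
    assume "v \<notin> K (x t)"
    then obtain a0 b0 where "a0 \<bullet> v < b0" "\<forall>w\<in>K (x t). b0 < a0 \<bullet> w"
      using separating_hyperplane_closed_point[OF convex closed] by blast
    then have "- b0 < (- a0) \<bullet> v" "\<And>w. w \<in> K (x t) \<Longrightarrow> (- a0) \<bullet> w < - b0" by auto
    then obtain a b where ab: "b < a \<bullet> v" "\<And>w. w \<in> K (x t) \<Longrightarrow> a \<bullet> w < b" by blast
    obtain d where "d > 0" and d: "\<And>w v. w \<in> ball (x t) d \<Longrightarrow> v \<in> K w \<Longrightarrow> a \<bullet> v \<le> b"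
      using usc[OF ab(2)] by blast
    \<comment> \<open>A third of \<open>d\<close> each is spent on the distance of the polygon from \<open>x\<close> at time \<open>t\<close>, on the
      motion during a time span below \<open>\<eta>\<close>, and on one Euler step.\<close>
    define \<eta> where "\<eta> = d / (3 * (M + 1))"
    have "\<eta> > 0" using \<open>d > 0\<close> \<open>M \<ge> 0\<close> by (simp add: \<eta>_def)
    have "M * \<eta> \<le> (M + 1) * \<eta>" using \<open>\<eta> > 0\<close> by (intro mult_right_mono) auto
    also have "\<dots> = d / 3" using \<open>M \<ge> 0\<close> by (simp add: \<eta>_def field_simps)
    finally have M\<eta>: "M * \<eta> \<le> d / 3" .
    have incr: "a \<bullet> (x s - x t) \<le> b * (s - t)" if s: "t < s" "s < t + \<eta>" for s
    proof (rule tendsto_upperbound)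
      show "(\<lambda>n. a \<bullet> (Y (r n) s - Y (r n) t)) \<longlonglongrightarrow> a \<bullet> (x s - x t)" by (intro tendsto_intros x)
      have "\<forall>\<^sub>F n in sequentially. s \<le> real (r n)"
        using filterlim_compose[OF filterlim_real_sequentially filterlim_subseq[OF r]]
        by (simp add: filterlim_at_top)
      moreover have "\<forall>\<^sub>F n in sequentially. 1 / real (Suc (r n)) < \<eta>"
        using filterlim_compose[OF LIMSEQ_Suc[OF lim_1_over_n] filterlim_subseq[OF r]] \<open>\<eta> > 0\<close>
        by (intro order_tendstoD(2)[of _ 0]) auto
      moreover have "\<forall>\<^sub>F n in sequentially. dist (Y (r n) t) (x t) < d / 3"
        using x[of t] \<open>d > 0\<close> by (intro tendstoD) auto
      ultimately show "\<forall>\<^sub>F n in sequentially. a \<bullet> (Y (r n) s - Y (r n) t) \<le> b * (s - t)"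
      proof eventually_elim
        case (elim n)
        show ?case
        proof (rule Y)
          fix z assume z: "norm (z - Y (r n) t) \<le> M * (s - t + 1 / Suc (r n))"
          also have "\<dots> \<le> M * (\<eta> + \<eta>)" using elim s by (intro mult_left_mono \<open>M \<ge> 0\<close>) auto
          also have "\<dots> \<le> d / 3 + d / 3" using M\<eta> by (simp add: algebra_simps)
          finally have "dist z (Y (r n) t) \<le> d / 3 + d / 3" by (simp add: dist_norm)
          then have "dist (x t) z < d"
            using elim(3) dist_triangle[of "x t" z "Y (r n) t"] by (simp add: dist_commute)
          then show "a \<bullet> g z \<le> b" by (intro d[of z] g) simp
        qed (use s elim \<open>t \<ge> 0\<close> in auto)
      qed
    qed simp
    have "((\<lambda>s. a \<bullet> x s - b * s) has_real_derivative (a \<bullet> v - b)) (at t)"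
      using bounded_linear.has_vector_derivative[OF bounded_linear_inner_right v, of a]
      unfolding has_real_derivative_iff_has_vector_derivative[symmetric]
      by (auto intro!: derivative_eq_intros)
    from DERIV_pos_inc_right[OF this] ab(1) obtain e where "e > 0"
      and e: "\<And>h. h > 0 \<Longrightarrow> h < e \<Longrightarrow> a \<bullet> x t - b * t < a \<bullet> x (t + h) - b * (t + h)"
      by auto
    define h where "h = min \<eta> e / 2"
    have "h > 0" "h < e" "h < \<eta>" using \<open>e > 0\<close> \<open>\<eta> > 0\<close> by (auto simp: h_def)
    with e[of h] incr[of "t + h"] show False by (simp add: inner_diff_right algebra_simps)
  qed
  have "{t. 0 \<le> t \<and> \<not> (\<exists>v\<in>K (x t). (x has_vector_derivative v) (at t))} \<subseteq> {t. \<not> x differentiable (at t)}"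
    using inK by (auto simp: vector_derivative_works)
  then have "negligible {t. 0 \<le> t \<and> \<not> (\<exists>v\<in>K (x t). (x has_vector_derivative v) (at t))}"
    by (rule negligible_subset[OF lipschitz_negligible_nondifferentiable[OF xlip]])
  with \<open>x 0 = \<xi>\<close> xlip show ?thesis using that by blast
qed

section \<open>Quadratic functions\<close>

lemma symmetric_inner_commute:
  fixes P :: "real^'n^'n"
  assumes "transpose P = P"
  shows "u \<bullet> (P *v w) = w \<bullet> (P *v u)"
  by (metis assms dot_lmul_matrix inner_commute transpose_matrix_vector)

lemma quadratic_at_has_derivative:
  assumes "transpose P = P"
  shows "(quadratic_at x0 P has_derivative (\<lambda>h. 2 * ((x - x0) \<bullet> (P *v h)))) (at x within S)"
proof -
  have "((\<lambda>x. (x - x0) \<bullet> (P *v (x - x0))) has_derivative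
      (\<lambda>h. (x - x0) \<bullet> (P *v (h - 0)) + (h - 0) \<bullet> (P *v (x - x0)))) (at x within S)"
    by (intro has_derivative_inner bounded_linear.has_derivative[OF matrix_vector_mul_bounded_linear]
        has_derivative_diff has_derivative_ident has_derivative_const)
  moreover have "(\<lambda>h. (x - x0) \<bullet> (P *v (h - 0)) + (h - 0) \<bullet> (P *v (x - x0))) = (\<lambda>h. 2 * ((x - x0) \<bullet> (P *v h)))"
    using symmetric_inner_commute[OF assms] by fastforce
  moreover have "quadratic_at x0 P = (\<lambda>x. (x - x0) \<bullet> (P *v (x - x0)))"
    by (simp add: quadratic_at_def fun_eq_iff)
  ultimately show ?thesis by simp
qed

lemma frechet_derivative_quadratic_at:
  assumes "transpose P = P"
  shows "frechet_derivative (quadratic_at x0 P) (at x) = (\<lambda>h. 2 * ((x - x0) \<bullet> (P *v h)))"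
  using frechet_derivative_at[OF quadratic_at_has_derivative[OF assms]] by simp

lemma hessian_quadratic_at:
  fixes P :: "real^'n^'n"
  assumes "transpose P = P"
  shows "hessian (quadratic_at x0 P) x = 2 *\<^sub>R P"
proof -
  have "gradient (quadratic_at x0 P) y = 2 *\<^sub>R (P *v (y - x0))" for y
    unfolding gradient_def frechet_derivative_quadratic_at[OF assms]
    by (simp add: vec_eq_iff symmetric_inner_commute[OF assms, of "y - x0"] inner_axis')
  then have "gradient (quadratic_at x0 P) = (\<lambda>y. 2 *\<^sub>R (P *v (y - x0)))" by blast
  moreover have "((\<lambda>y. 2 *\<^sub>R (P *v (y - x0))) has_derivative (\<lambda>h. 2 *\<^sub>R (P *v (h - 0)))) (at x)"
    by (intro bounded_linear.has_derivative[OF bounded_linear_scaleR_right]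
        bounded_linear.has_derivative[OF matrix_vector_mul_bounded_linear]
        has_derivative_diff has_derivative_ident has_derivative_const)
  ultimately have "frechet_derivative (gradient (quadratic_at x0 P)) (at x) = (\<lambda>h. 2 *\<^sub>R (P *v h))"
    using frechet_derivative_at by force
  then have "hessian (quadratic_at x0 P) x = matrix (\<lambda>h. (2 *\<^sub>R P) *v h)"
    by (simp add: hessian_def jacobian_def scaleR_matrix_vector_assoc)
  then show ?thesis by simp
qed

text \<open>
  The bounds are the extreme values of the quadratic form on the unit sphere.
\<close>

lemma sym_pos_def_bounds:
  fixes P :: "real^'n^'n"
  assumes "sym_pos_def P"
  obtains m B where "m > 0" "B > 0" "\<And>v. m * (norm v)\<^sup>2 \<le> v \<bullet> (P *v v)" "\<And>v. v \<bullet> (P *v v) \<le> B * (norm v)\<^sup>2"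
proof -
  let ?q = "\<lambda>v. v \<bullet> (P *v v)"
  have cont: "continuous_on (sphere 0 1) ?q"
    by (intro continuous_intros linear_continuous_on matrix_vector_mul_bounded_linear)
  have ne: "sphere (0 :: real^'n) 1 \<noteq> {}" by simp
  obtain u where u: "u \<in> sphere 0 1" "\<And>v. v \<in> sphere 0 1 \<Longrightarrow> ?q u \<le> ?q v"
    using continuous_attains_inf[OF compact_sphere ne cont] by blast
  obtain w where w: "w \<in> sphere 0 1" "\<And>v. v \<in> sphere 0 1 \<Longrightarrow> ?q v \<le> ?q w"
    using continuous_attains_sup[OF compact_sphere ne cont] by blast
  have pos: "?q v > 0" if "v \<in> sphere 0 1" for v
  proof -
    have "v \<noteq> 0" using that by auto
    then show ?thesis using assms by (simp add: sym_pos_def_def)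
  qed
  have scale: "?q v = (norm v)\<^sup>2 * ?q (v /\<^sub>R norm v)" for v
  proof (cases "v = 0")
    case False
    have "?q (norm v *\<^sub>R (v /\<^sub>R norm v)) = (norm v)\<^sup>2 * ?q (v /\<^sub>R norm v)"
      unfolding matrix_vector_mult_scaleR inner_scaleR_left inner_scaleR_right power2_eq_square by simp
    with False show ?thesis by simp
  qed simp
  show ?thesis
  proof (rule that[of "?q u" "?q w"])
    fix v :: "real^'n"
    have "?q u * (norm v)\<^sup>2 \<le> ?q v \<and> ?q v \<le> ?q w * (norm v)\<^sup>2"
    proof (cases "v = 0")
      case False
      then have "v /\<^sub>R norm v \<in> sphere 0 1" by simp
      then have "?q u \<le> ?q (v /\<^sub>R norm v)" "?q (v /\<^sub>R norm v) \<le> ?q w" using u(2) w(2) by blast+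
      then show ?thesis
        unfolding scale[of v] mult.commute[of _ "(norm v)\<^sup>2"] by (intro conjI mult_left_mono) auto
    qed simp
    then show "?q u * (norm v)\<^sup>2 \<le> ?q v" "?q v \<le> ?q w * (norm v)\<^sup>2" by auto
  qed (use pos u(1) w(1) in auto)
qed

section \<open>Solutions of differential inclusions\<close>

lemma AE_lebesgue_iff_negligible: "(AE t in lebesgue. Q t) \<longleftrightarrow> negligible {t. \<not> Q t}"
proof
  assume "AE t in lebesgue. Q t"
  then obtain N where "N \<in> null_sets lebesgue" "{t. \<not> Q t} \<subseteq> N" by (auto simp: eventually_ae_filter)
  then show "negligible {t. \<not> Q t}" using negligible_subset negligible_iff_null_sets by blast
next
  assume "negligible {t. \<not> Q t}"
  then show "AE t in lebesgue. Q t"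
    unfolding eventually_ae_filter negligible_iff_null_sets by auto
qed

lemma inclusion_solutionI:
  assumes "is_interval J" "0 \<in> J" "J \<subseteq> {0..}" "M-lipschitz_on J x"
    and "negligible {t. t \<in> J \<and> \<not> (\<exists>v\<in>K (x t). (x has_vector_derivative v) (at t within J))}"
  shows "inclusion_solution K J x"
  unfolding inclusion_solution_def AE_lebesgue_iff_negligible
  using assms by (auto intro: lipschitz_imp_abs_continuous_on lipschitz_on_subset)

lemma inclusion_solutionE:
  assumes "inclusion_solution K J x" "{s..t} \<subseteq> J"
  obtains N where "negligible N" "abs_continuous_on s t x"
    "\<And>r. r \<in> {s..t} - N \<Longrightarrow> \<exists>v\<in>K (x r). (x has_vector_derivative v) (at r within {s..t})"
proof -
  define N where "N = {t. \<not> (t \<in> J \<longrightarrow> (\<exists>v\<in>K (x t). (x has_vector_derivative v) (at t within J)))}"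
  show ?thesis
  proof (rule that[of N])
    show "negligible N" "abs_continuous_on s t x"
      using assms by (auto simp: inclusion_solution_def AE_lebesgue_iff_negligible N_def)
    show "\<exists>v\<in>K (x r). (x has_vector_derivative v) (at r within {s..t})" if "r \<in> {s..t} - N" for r
      using that assms(2) has_vector_derivative_within_subset unfolding N_def by blast
  qed
qed

text \<open>
  On the compact trajectory piece the quadratic function is Lipschitz, so its composition with the
  solution is again absolutely continuous and its increment is controlled by its derivative.
\<close>

lemma quadratic_increment_le:
  fixes x :: "real \<Rightarrow> real^'n"
  assumes sol: "inclusion_solution K J x" and st: "{s..t} \<subseteq> J" "s \<le> t" and P: "transpose P = P"
    and c: "\<And>r v. r \<in> {s..t} \<Longrightarrow> v \<in> K (x r) \<Longrightarrow> 2 * ((x r - x0) \<bullet> (P *v v)) \<le> c"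
  shows "quadratic_at x0 P (x t) - quadratic_at x0 P (x s) \<le> c * (t - s)"
proof -
  obtain N where N: "negligible N" and ac: "abs_continuous_on s t x"
    and der: "\<And>r. r \<in> {s..t} - N \<Longrightarrow> \<exists>v\<in>K (x r). (x has_vector_derivative v) (at r within {s..t})"
    by (rule inclusion_solutionE[OF sol st(1)]) (rule that)
  obtain R where R: "\<And>r. r \<in> {s..t} \<Longrightarrow> norm (x r - x0) \<le> R"
  proof -
    have "continuous_on {s..t} (\<lambda>r. x r - x0)"
      using abs_continuous_on_imp_continuous_on[OF ac] by (intro continuous_intros)
    then have "bounded ((\<lambda>r. x r - x0) ` {s..t})" by (intro compact_imp_bounded compact_continuous_image) auto
    then show ?thesis using that unfolding bounded_iff by blast
  qed
  obtain B where B: "B > 0" "\<And>v. norm (P *v v) \<le> norm v * B"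
    using bounded_linear.pos_bounded[OF matrix_vector_mul_bounded_linear[of P]] by blast
  show ?thesis
  proof (rule abs_continuous_on_increment_le[OF st(2) _ N])
    show "abs_continuous_on s t (\<lambda>r. quadratic_at x0 P (x r))"
    proof (rule abs_continuous_on_compose_lipschitz[OF ac])
      fix r r' assume r: "r \<in> {s..t}" "r' \<in> {s..t}"
      define u w where "u = x r - x0" and "w = x r' - x0"
      have "quadratic_at x0 P (x r) - quadratic_at x0 P (x r') = (u - w) \<bullet> (P *v (u + w))"
        using symmetric_inner_commute[OF P, of u w]
        by (simp add: quadratic_at_def u_def[symmetric] w_def[symmetric] algebra_simps
            matrix_vector_right_distrib inner_diff_left inner_add_right)
      then have "dist (quadratic_at x0 P (x r)) (quadratic_at x0 P (x r')) \<le> norm (u - w) * norm (P *v (u + w))"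
        by (simp add: dist_real_def Cauchy_Schwarz_ineq2)
      also have "\<dots> \<le> norm (u - w) * (norm (u + w) * B)" by (intro mult_left_mono B) simp
      also have "\<dots> \<le> norm (u - w) * ((R + R) * B)"
        using R[OF r(1)] R[OF r(2)] norm_triangle_ineq[of u w] B(1)
        by (intro mult_left_mono mult_right_mono) (auto simp: u_def w_def)
      finally show "dist (quadratic_at x0 P (x r)) (quadratic_at x0 P (x r')) \<le> ((R + R) * B) * dist (x r) (x r')"
        by (simp add: u_def w_def dist_norm mult_ac)
    qed
    fix r assume r: "r \<in> {s..t} - N"
    obtain v where v: "v \<in> K (x r)" "(x has_vector_derivative v) (at r within {s..t})" using der[OF r] by blast
    have "((quadratic_at x0 P \<circ> x) has_derivative ((\<lambda>h. 2 * ((x r - x0) \<bullet> (P *v h))) \<circ> (\<lambda>h. h *\<^sub>R v)))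
        (at r within {s..t})"
      using v(2) unfolding has_vector_derivative_def
      by (rule diff_chain_within) (rule quadratic_at_has_derivative[OF P])
    then have "((\<lambda>r. quadratic_at x0 P (x r)) has_real_derivative 2 * ((x r - x0) \<bullet> (P *v v))) (at r within {s..t})"
      unfolding has_field_derivative_def o_def
      by (rule has_derivative_eq_rhs) (simp add: fun_eq_iff matrix_vector_mult_scaleR)
    then show "\<exists>D\<le>c. ((\<lambda>r. quadratic_at x0 P (x r)) has_real_derivative D) (at r within {s..t})"
      using c[OF _ v(1)] r by blast
  qed
qed

section \<open>Lyapunov's theorem for dissipative inclusions\<close>

text \<open>
  The left-hand side in \<open>decay\<close> is the derivative of \<open>quadratic_at x0 P\<close> at \<open>z\<close> in the direction \<open>v\<close>.
\<close>

locale dissipative_inclusion =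
  fixes K :: "real^'n \<Rightarrow> (real^'n) set" and x0 :: "real^'n" and P :: "real^'n^'n" and \<alpha> :: real
  assumes nonempty: "K z \<noteq> {}" and closed_values: "closed (K z)" and convex_values: "convex (K z)"
    and locally_bounded: "\<exists>M. \<forall>z\<in>cball x0 R. \<forall>v\<in>K z. norm v \<le> M"
    and usc: "(\<And>v. v \<in> K z \<Longrightarrow> a \<bullet> v < b) \<Longrightarrow> \<exists>d>0. \<forall>w\<in>ball z d. \<forall>v\<in>K w. a \<bullet> v \<le> b"
    and P: "sym_pos_def P" and \<alpha>: "\<alpha> > 0"
    and decay: "v \<in> K z \<Longrightarrow> 2 * ((z - x0) \<bullet> (P *v v)) \<le> - \<alpha> * (norm (z - x0))\<^sup>2"
begin

lemma P_sym: "transpose P = P"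
  using P by (simp add: sym_pos_def_def)

lemma Lyapunov_decreasing:
  assumes "inclusion_solution K J x" "{s..t} \<subseteq> J" "s \<le> t"
  shows "quadratic_at x0 P (x t) \<le> quadratic_at x0 P (x s)"
proof -
  have "2 * ((z - x0) \<bullet> (P *v v)) \<le> 0" if "v \<in> K z" for z v
    using decay[OF that] \<alpha> by (smt (verit) mult_nonneg_nonneg mult_minus_left zero_le_power2)
  then have "quadratic_at x0 P (x t) - quadratic_at x0 P (x s) \<le> 0 * (t - s)"
    by (intro quadratic_increment_le[OF assms P_sym])
  then show ?thesis by simp
qed

lemma sublevel_bounded: "\<exists>R>0. \<forall>z. quadratic_at x0 P z \<le> c \<longrightarrow> norm (z - x0) \<le> R"
proof -
  obtain m where m: "m > 0" "\<And>v. m * (norm v)\<^sup>2 \<le> v \<bullet> (P *v v)" using sym_pos_def_bounds[OF P] by metis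
  define R where "R = 1 + \<bar>c\<bar> / m"
  have "R \<ge> 1" using m(1) by (simp add: R_def)
  have "norm (z - x0) \<le> R" if "quadratic_at x0 P z \<le> c" for z
  proof (rule power2_le_imp_le)
    have "m * (norm (z - x0))\<^sup>2 \<le> \<bar>c\<bar>" using m(2)[of "z - x0"] that by (simp add: quadratic_at_def)
    then have "(norm (z - x0))\<^sup>2 \<le> \<bar>c\<bar> / m" using m(1) by (simp add: field_simps)
    also have "\<dots> \<le> R * 1" by (simp add: R_def)
    also have "\<dots> \<le> R * R" using \<open>R \<ge> 1\<close> by (intro mult_left_mono) auto
    finally show "(norm (z - x0))\<^sup>2 \<le> R\<^sup>2" by (simp add: power2_eq_square)
  qed (use \<open>R \<ge> 1\<close> in simp)
  then show ?thesis using \<open>R \<ge> 1\<close> by (intro exI[of _ R]) auto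
qed

text \<open>
  The existence theorem needs a bounded field. Composing \<open>K\<close> with the radial retraction \<open>\<pi>\<close> onto a
  large ball about \<open>x0\<close> provides one. As \<open>\<pi> z - x0\<close> is a positive multiple of \<open>z - x0\<close>, the
  quadratic function still does not increase along the truncated field. The trajectory therefore
  stays in its initial sublevel set, inside the ball, where the truncation has no effect.
\<close>

lemma global_solution_exists:
  obtains x M where "x 0 = \<xi>" "M-lipschitz_on UNIV x"
    "negligible {t. 0 \<le> t \<and> \<not> (\<exists>v\<in>K (x t). (x has_vector_derivative v) (at t))}"
proof -
  obtain R where R: "R > 0" "\<And>z. quadratic_at x0 P z \<le> quadratic_at x0 P \<xi> \<Longrightarrow> norm (z - x0) \<le> R"
    using sublevel_bounded by blast
  define s where "s z = R / max R (norm (z - x0))" for z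
  define \<pi> where "\<pi> z = x0 + s z *\<^sub>R (z - x0)" for z
  have max_pos: "max R (norm (z - x0)) > 0" for z using R(1) by (simp add: less_max_iff_disj)
  have s_pos: "s z > 0" for z using max_pos R(1) by (simp add: s_def)
  have \<pi>_cball: "\<pi> z \<in> cball x0 R" for z
  proof -
    have "s z * norm (z - x0) \<le> R"
      using max_pos[of z] R(1) by (simp add: s_def pos_divide_le_eq mult_left_mono)
    then show ?thesis using s_pos[of z] by (simp add: \<pi>_def dist_norm)
  qed
  have \<pi>_id: "\<pi> z = z" if "norm (z - x0) \<le> R" for z
    using that R(1) by (simp add: \<pi>_def s_def max_absorb1)
  have \<pi>_cont: "isCont \<pi> z" for z
    unfolding \<pi>_def s_def using max_pos[of z] by (intro continuous_intros) auto
  obtain M where M: "\<And>z v. z \<in> cball x0 R \<Longrightarrow> v \<in> K z \<Longrightarrow> norm v \<le> M" using locally_bounded by blast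
  obtain x where x: "x 0 = \<xi>" "M-lipschitz_on UNIV x"
    "negligible {t. 0 \<le> t \<and> \<not> (\<exists>v\<in>K (\<pi> (x t)). (x has_vector_derivative v) (at t))}"
  proof (rule differential_inclusion_exists[of "\<lambda>z. K (\<pi> z)" M \<xi>])
    show "norm v \<le> M" if "v \<in> K (\<pi> z)" for z v using M[OF \<pi>_cball that] .
    fix z a b assume "\<And>v. v \<in> K (\<pi> z) \<Longrightarrow> a \<bullet> v < b"
    then obtain d where d: "d > 0" "\<forall>w\<in>ball (\<pi> z) d. \<forall>v\<in>K w. a \<bullet> v \<le> b" using usc by blast
    obtain d' where d': "d' > 0" "\<And>w. dist w z < d' \<Longrightarrow> dist (\<pi> w) (\<pi> z) < d"
      using \<pi>_cont[of z] d(1) unfolding continuous_at_eps_delta by blast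
    show "\<exists>d>0. \<forall>w\<in>ball z d. \<forall>v\<in>K (\<pi> w). a \<bullet> v \<le> b"
      using d(2) d' by (intro exI[of _ d']) (auto simp: dist_commute)
  qed (use nonempty closed_values convex_values in auto)
  have sol: "inclusion_solution (\<lambda>z. K (\<pi> z)) {0..} x"
  proof (rule inclusion_solutionI)
    show "M-lipschitz_on {0..} x" using x(2) by (rule lipschitz_on_subset) simp
    show "negligible {t. t \<in> {0..} \<and> \<not> (\<exists>v\<in>K (\<pi> (x t)). (x has_vector_derivative v) (at t within {0..}))}"
      by (rule negligible_subset[OF x(3)]) (auto intro: has_vector_derivative_at_within)
  qed (auto simp: is_interval_ci)
  have inR: "norm (x t - x0) \<le> R" if "t \<ge> 0" for t
  proof (rule R(2))
    have "2 * ((z - x0) \<bullet> (P *v v)) \<le> 0" if "v \<in> K (\<pi> z)" for z v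
    proof -
      have "s z * (2 * ((z - x0) \<bullet> (P *v v))) = 2 * ((\<pi> z - x0) \<bullet> (P *v v))" by (simp add: \<pi>_def)
      also have "\<dots> \<le> - \<alpha> * (norm (\<pi> z - x0))\<^sup>2" using decay[OF that] .
      also have "\<dots> \<le> 0" using \<alpha> by simp
      finally show ?thesis using s_pos[of z] by (simp add: mult_le_0_iff)
    qed
    then have "quadratic_at x0 P (x t) - quadratic_at x0 P (x 0) \<le> 0 * (t - 0)"
      using that by (intro quadratic_increment_le[OF sol _ _ P_sym]) auto
    then show "quadratic_at x0 P (x t) \<le> quadratic_at x0 P \<xi>" using x(1) by simp
  qed
  have "{t. 0 \<le> t \<and> \<not> (\<exists>v\<in>K (x t). (x has_vector_derivative v) (at t))} \<subseteq>
      {t. 0 \<le> t \<and> \<not> (\<exists>v\<in>K (\<pi> (x t)). (x has_vector_derivative v) (at t))}"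
    using \<pi>_id[OF inR] by auto
  with x show ?thesis using that negligible_subset by blast
qed

text \<open>
  The solution stays in its initial sublevel set, which is bounded, so its velocity is bounded
  as well.
\<close>

lemma solution_lipschitz:
  assumes sol: "inclusion_solution K J x"
  shows "\<exists>M. M-lipschitz_on J x"
proof -
  have J: "is_interval J" "0 \<in> J" "J \<subseteq> {0..}" using sol by (auto simp: inclusion_solution_def)
  have sub: "{s..t} \<subseteq> J" if "s \<in> J" "t \<in> J" for s t
    using J(1) that unfolding is_interval_1 by (meson atLeastAtMost_iff subsetI)
  obtain R where R: "\<And>z. quadratic_at x0 P z \<le> quadratic_at x0 P (x 0) \<Longrightarrow> norm (z - x0) \<le> R"
    using sublevel_bounded by blast
  obtain M where M: "\<And>z v. z \<in> cball x0 R \<Longrightarrow> v \<in> K z \<Longrightarrow> norm v \<le> M" using locally_bounded by blast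
  have M': "norm v \<le> M" if "t \<in> J" "v \<in> K (x t)" for t v
  proof (rule M[OF _ that(2)])
    have "quadratic_at x0 P (x t) \<le> quadratic_at x0 P (x 0)"
      using J that(1) sub by (intro Lyapunov_decreasing[OF sol]) auto
    then show "x t \<in> cball x0 R" using R[of "x t"] by (simp add: dist_norm norm_minus_commute[of x0])
  qed
  obtain v where "v \<in> K (x 0)" using nonempty by blast
  then have "M \<ge> 0" using M'[OF J(2)] norm_ge_zero order_trans by blast
  have "M-lipschitz_on J x"
  proof (rule lipschitz_on_leI)
    fix s t assume st: "s \<in> J" "t \<in> J" "s \<le> t"
    obtain N where N: "negligible N" and ac: "abs_continuous_on s t x"
      and der: "\<And>r. r \<in> {s..t} - N \<Longrightarrow> \<exists>v\<in>K (x r). (x has_vector_derivative v) (at r within {s..t})"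
      by (rule inclusion_solutionE[OF sol sub[OF st(1,2)]]) (rule that)
    have "norm (x t - x s) \<le> M * (t - s)"
    proof (rule abs_continuous_on_norm_increment_le[OF st(3) ac N])
      fix r assume r: "r \<in> {s..t} - N"
      then have "r \<in> J" using sub[OF st(1,2)] by blast
      then show "\<exists>v. norm v \<le> M \<and> (x has_vector_derivative v) (at r within {s..t})"
        using der[OF r] M' by blast
    qed
    then show "dist (x s) (x t) \<le> M * dist s t"
      using st(3) by (simp add: dist_norm norm_minus_commute)
  qed (rule \<open>M \<ge> 0\<close>)
  then show ?thesis ..
qed

text \<open>
  If \<open>J\<close> is bounded with right end \<open>b\<close>, the solution, being Lipschitz, has a limit at \<open>b\<close> even
  when \<open>b\<close> is not in \<open>J\<close>. A global solution started there is appended.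
\<close>

lemma solution_extends:
  assumes sol: "inclusion_solution K J x"
  shows "\<exists>y. inclusion_solution K {0..} y \<and> (\<forall>t\<in>J. y t = x t)"
proof -
  have J: "is_interval J" "0 \<in> J" "J \<subseteq> {0..}" using sol by (auto simp: inclusion_solution_def)
  have sub: "r \<in> J" if "t \<in> J" "0 \<le> r" "r \<le> t" for r t
    using J(1,2) that unfolding is_interval_1 by blast
  show ?thesis
  proof (cases "bdd_above J")
    case False
    have "t \<in> J" if "t \<ge> 0" for t
    proof -
      from False obtain s where "s \<in> J" "s > t" by (auto simp: bdd_above_def not_le)
      then show ?thesis using sub[of s t] that by simp
    qed
    then have "J = {0..}" using J(3) by auto
    then show ?thesis using sol by blast
  next
    case True
    define b where "b = Sup J"
    have b: "t \<le> b" if "t \<in> J" for t using True that by (simp add: b_def cSup_upper)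
    have "b \<ge> 0" using b J(2) by simp
    have below: "t \<in> J" if "0 \<le> t" "t < b" for t
    proof -
      have "\<exists>s\<in>J. t < s" using that(2) J(2) unfolding b_def by (intro less_cSupD) auto
      then obtain s where "s \<in> J" "t < s" by blast
      then show ?thesis using sub[of s t] that by simp
    qed
    have "b \<in> closure J" using J(2) True unfolding b_def by (intro closure_contains_Sup) auto
    have cl: "{0..b} \<subseteq> closure J"
    proof
      fix t assume "t \<in> {0..b}"
      then show "t \<in> closure J"
        using below[of t] closure_subset[of J] \<open>b \<in> closure J\<close> by (cases "t = b") auto
    qed
    obtain M where "M-lipschitz_on J x" using solution_lipschitz[OF sol] by blast
    then obtain g where g: "M-lipschitz_on (closure J) g" "\<And>t. t \<in> J \<Longrightarrow> g t = x t"
      using lipschitz_extend_closure by blast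
    obtain z M' where z: "z 0 = g b" "M'-lipschitz_on UNIV z"
      "negligible {t. 0 \<le> t \<and> \<not> (\<exists>v\<in>K (z t). (z has_vector_derivative v) (at t))}"
      using global_solution_exists .
    define y where "y t = (if t \<le> b then g t else z (t - b))" for t
    have yx: "y t = x t" if "t \<in> J" for t using b[OF that] g(2)[OF that] by (simp add: y_def)
    have ylip: "(max M M')-lipschitz_on {0..} y"
    proof (rule lipschitz_onI)
      show "0 \<le> max M M'" using lipschitz_on_nonneg[OF g(1)] by simp
      fix s t :: real assume st: "s \<in> {0..}" "t \<in> {0..}"
      have "M'-lipschitz_on {b..max s t} (\<lambda>t. z (t - b))"
      proof (rule lipschitz_onI)
        fix s' t'
        have "dist (z (s' - b)) (z (t' - b)) \<le> M' * dist (s' - b) (t' - b)"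
          using z(2) by (rule lipschitz_onD) auto
        then show "dist (z (s' - b)) (z (t' - b)) \<le> M' * dist s' t'" by (simp add: dist_norm)
      qed (rule lipschitz_on_nonneg[OF z(2)])
      then have "(max M M')-lipschitz_on {0..max s t} y"
        unfolding y_def[abs_def]
        by (intro lipschitz_on_concat_max lipschitz_on_subset[OF g(1) cl]) (simp_all add: z(1))
      then show "dist (y s) (y t) \<le> max M M' * dist s t"
        by (rule lipschitz_onD) (use st in auto)
    qed
    define N1 where "N1 = {t. \<not> (t \<in> J \<longrightarrow> (\<exists>v\<in>K (x t). (x has_vector_derivative v) (at t within J)))}"
    define N2 where "N2 = {t. 0 \<le> t \<and> \<not> (\<exists>v\<in>K (z t). (z has_vector_derivative v) (at t))}"
    have N1: "negligible N1"
      using sol by (auto simp: inclusion_solution_def AE_lebesgue_iff_negligible N1_def)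
    have "inclusion_solution K {0..} y"
    proof (rule inclusion_solutionI[OF _ _ _ ylip])
      have neg: "negligible (N1 \<union> {0, b} \<union> (+) b ` N2)"
        using N1 z(3) by (intro negligible_Un negligible_translation) (auto simp: N2_def)
      show "negligible {t. t \<in> {0..} \<and> \<not> (\<exists>v\<in>K (y t). (y has_vector_derivative v) (at t within {0..}))}"
      proof (rule negligible_subset[OF neg], rule subsetI, rule ccontr)
        fix t assume t: "t \<in> {t. t \<in> {0..} \<and> \<not> (\<exists>v\<in>K (y t). (y has_vector_derivative v) (at t within {0..}))}"
          "t \<notin> N1 \<union> {0, b} \<union> (+) b ` N2"
        then have "t > 0" "t \<noteq> b" "t \<notin> N1" by auto
        have "\<exists>v\<in>K (y t). (y has_vector_derivative v) (at t)"
        proof (cases "t < b")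
          case True
          then have "t \<in> J" using below \<open>t > 0\<close> by simp
          then obtain v where v: "v \<in> K (x t)" "(x has_vector_derivative v) (at t within J)"
            using \<open>t \<notin> N1\<close> by (auto simp: N1_def)
          have sub: "{0<..<b} \<subseteq> J" using below by auto
          have "(x has_vector_derivative v) (at t within {0<..<b})"
            using has_vector_derivative_within_subset[OF v(2) sub] .
          then have "(x has_vector_derivative v) (at t)"
            using True \<open>t > 0\<close> by (simp add: at_within_open[of t "{0<..<b}"])
          then have "(y has_vector_derivative v) (at t)"
            by (rule has_vector_derivative_transform_within_open[where S = "{0<..<b}"])
               (use True \<open>t > 0\<close> sub yx in auto)
          then show ?thesis using v(1) yx[OF \<open>t \<in> J\<close>] by auto
        next
          case False
          then have "t > b" using \<open>t \<noteq> b\<close> by simp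
          have "t - b \<notin> N2"
          proof
            assume "t - b \<in> N2"
            then have "b + (t - b) \<in> (+) b ` N2" by (rule imageI)
            then show False using t(2) by simp
          qed
          then obtain v where v: "v \<in> K (z (t - b))" "(z has_vector_derivative v) (at (t - b))"
            using \<open>t > b\<close> by (auto simp: N2_def)
          have "((\<lambda>t. t - b) has_vector_derivative 1) (at t)"
            by (auto intro!: derivative_eq_intros)
          from vector_diff_chain_at[OF this v(2)]
          have "((\<lambda>t. z (t - b)) has_vector_derivative v) (at t)" by (simp add: o_def)
          then have "(y has_vector_derivative v) (at t)"
            by (rule has_vector_derivative_transform_within_open[where S = "{b<..}"])
               (use \<open>t > b\<close> in \<open>auto simp: y_def\<close>)
          then show ?thesis using v(1) \<open>t > b\<close> by (auto simp: y_def)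
        qed
        then show False using t(1) by (auto intro: has_vector_derivative_at_within)
      qed
    qed (auto simp: is_interval_ci)
    then show ?thesis using yx by blast
  qed
qed

lemma solutions_stable:
  assumes "\<epsilon> > 0"
  shows "\<exists>\<delta>>0. \<forall>x. inclusion_solution K {0..} x \<and> norm (x 0 - x0) < \<delta> \<longrightarrow> (\<forall>t\<ge>0. norm (x t - x0) < \<epsilon>)"
proof -
  obtain m B where mB: "m > 0" "B > 0" "\<And>v. m * (norm v)\<^sup>2 \<le> v \<bullet> (P *v v)" "\<And>v. v \<bullet> (P *v v) \<le> B * (norm v)\<^sup>2"
    using sym_pos_def_bounds[OF P] by blast
  define \<delta> where "\<delta> = sqrt (m / B) * \<epsilon>"
  show ?thesis
  proof (intro exI[of _ \<delta>] conjI allI impI)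
    show "\<delta> > 0" using mB assms by (simp add: \<delta>_def)
    fix x and t :: real assume x: "inclusion_solution K {0..} x \<and> norm (x 0 - x0) < \<delta>" and "t \<ge> 0"
    then have "quadratic_at x0 P (x t) \<le> quadratic_at x0 P (x 0)"
      by (intro Lyapunov_decreasing[of "{0..}"]) auto
    then have "m * (norm (x t - x0))\<^sup>2 \<le> B * (norm (x 0 - x0))\<^sup>2"
      using mB(3)[of "x t - x0"] mB(4)[of "x 0 - x0"] by (simp add: quadratic_at_def)
    also have "\<dots> < B * \<delta>\<^sup>2"
      using x mB(2) by (intro mult_strict_left_mono power_strict_mono) auto
    also have "\<dots> = m * \<epsilon>\<^sup>2" using mB by (simp add: \<delta>_def power_mult_distrib)
    finally show "norm (x t - x0) < \<epsilon>"
      using mB(1) assms by (simp add: power_less_imp_less_base)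
  qed
qed

text \<open>
  Away from \<open>x0\<close> the decay rate is bounded below, so the nonnegative quadratic function cannot
  stay above any positive level \<open>\<beta>\<close>; once below, it remains there.
\<close>

lemma solutions_attracted:
  assumes sol: "inclusion_solution K {0..} x"
  shows "(x \<longlongrightarrow> x0) at_top"
proof (rule tendstoI)
  fix e :: real assume "e > 0"
  obtain m B where mB: "m > 0" "B > 0" "\<And>v. m * (norm v)\<^sup>2 \<le> v \<bullet> (P *v v)" "\<And>v. v \<bullet> (P *v v) \<le> B * (norm v)\<^sup>2"
    using sym_pos_def_bounds[OF P] by blast
  let ?V = "\<lambda>t. quadratic_at x0 P (x t)"
  define \<beta> where "\<beta> = m * e\<^sup>2"
  have "\<beta> > 0" using \<open>e > 0\<close> mB by (simp add: \<beta>_def)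
  have "\<exists>s\<ge>0. ?V s < \<beta>"
  proof (rule ccontr)
    assume "\<not> ?thesis"
    then have V: "?V r \<ge> \<beta>" if "r \<ge> 0" for r using that by (auto simp: not_less)
    define c where "c = \<alpha> * (\<beta> / B)"
    have "c > 0" using \<alpha> \<open>\<beta> > 0\<close> mB by (simp add: c_def)
    have slope: "2 * ((x r - x0) \<bullet> (P *v v)) \<le> - c" if "r \<ge> 0" "v \<in> K (x r)" for r v
    proof -
      have "\<beta> \<le> B * (norm (x r - x0))\<^sup>2"
        using V[OF that(1)] mB(4)[of "x r - x0"] by (simp add: quadratic_at_def)
      then have "\<beta> / B \<le> (norm (x r - x0))\<^sup>2" using mB(2) by (simp add: field_simps)
      then have "c \<le> \<alpha> * (norm (x r - x0))\<^sup>2" unfolding c_def using \<alpha> by (intro mult_left_mono) auto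
      then show ?thesis using decay[OF that(2)] by simp
    qed
    \<comment> \<open>By this time, decay at rate \<open>c\<close> would have used up the initial value.\<close>
    define T where "T = ?V 0 / c"
    have "T \<ge> 0" using V[of 0] \<open>\<beta> > 0\<close> \<open>c > 0\<close> by (simp add: T_def)
    have "?V T - ?V 0 \<le> - c * (T - 0)"
      using \<open>T \<ge> 0\<close> slope by (intro quadratic_increment_le[OF sol _ _ P_sym]) auto
    then have "?V T \<le> 0" using \<open>c > 0\<close> by (simp add: T_def)
    with V[OF \<open>T \<ge> 0\<close>] \<open>\<beta> > 0\<close> show False by simp
  qed
  then obtain s where s: "s \<ge> 0" "?V s < \<beta>" by blast
  show "\<forall>\<^sub>F t in at_top. dist (x t) x0 < e"
  proof (rule eventually_mono[OF eventually_ge_at_top[of s]])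
    fix t assume "s \<le> t"
    then have "?V t \<le> ?V s" using s(1) by (intro Lyapunov_decreasing[OF sol]) auto
    then have "m * (norm (x t - x0))\<^sup>2 < m * e\<^sup>2"
      using s(2) mB(3)[of "x t - x0"] by (simp add: quadratic_at_def \<beta>_def)
    then show "dist (x t) x0 < e"
      using mB(1) \<open>e > 0\<close> by (simp add: dist_norm power_less_imp_less_base)
  qed
qed

theorem quadratic_Lyapunov_stability:
  assumes "0 \<in> K x0"
  shows "quadratically_globally_stable K x0"
  unfolding quadratically_globally_stable_def globally_asymptotically_stable_def
proof (intro conjI exI[of _ P] exI[of _ \<alpha>])
  show "\<forall>x. x \<noteq> x0 \<longrightarrow> (\<forall>\<xi>\<in>K x. frechet_derivative (quadratic_at x0 P) (at x) \<xi> \<le> - \<alpha> * (norm (x - x0))\<^sup>2)"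
    using decay by (simp add: frechet_derivative_quadratic_at[OF P_sym])
qed (use assms P \<alpha> solution_extends solutions_stable solutions_attracted in auto)

end

section \<open>The Filippov field of a switched system\<close>

lemma C1_imp_continuous: "C1 f \<Longrightarrow> isCont f x"
  using has_derivative_continuous by (fastforce simp: C1_def)

lemma filippov_field_eq:
  "filippov_field fm fp \<sigma> z = (if \<sigma> z < 0 then {fm z} else if \<sigma> z > 0 then {fp z} else closed_segment (fp z) (fm z))"
  by (auto simp: filippov_field_def closed_segment_def add.commute)

lemma filippov_field_subset_segment: "filippov_field fm fp \<sigma> z \<subseteq> closed_segment (fp z) (fm z)"
  by (auto simp: filippov_field_eq)

lemma halfspace_upper_semicontinuous:
  fixes f :: "'a::metric_space \<Rightarrow> 'b::real_inner"
  assumes "isCont f z" "a \<bullet> f z < b"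
  shows "\<exists>d>0. \<forall>w\<in>ball z d. a \<bullet> f w < b"
proof -
  have "isCont (\<lambda>w. a \<bullet> f w) z" using assms(1) by (intro continuous_intros)
  then have "\<forall>\<^sub>F w in at z. a \<bullet> f w < b" using assms(2) unfolding isCont_def by (rule order_tendstoD)
  then obtain d where "d > 0" "\<And>w. w \<noteq> z \<Longrightarrow> dist w z < d \<Longrightarrow> a \<bullet> f w < b"
    unfolding eventually_at by auto
  then show ?thesis using assms(2) by (intro exI[of _ d]) (auto simp: dist_commute, metis dist_commute)
qed

lemma segment_halfspace:
  assumes "a \<bullet> p \<le> b" "a \<bullet> q \<le> b" "v \<in> closed_segment p q"
  shows "a \<bullet> v \<le> (b::real)"
proof -
  have "closed_segment p q \<subseteq> {v. a \<bullet> v \<le> b}"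
    by (rule closed_segment_subset) (use assms in \<open>auto simp: convex_halfspace_le\<close>)
  then show ?thesis using assms(3) by blast
qed

text \<open>
  Off the switching surface the field is locally a single continuous vector field. On it, the
  value is the full segment, so that nearby values, each a subset of the nearby segment, cannot leave
  an open half-space that contains it.
\<close>

lemma filippov_field_usc:
  fixes fm fp :: "real^'n \<Rightarrow> real^'n" and w :: "real^'n"
  assumes cont: "\<And>z. isCont fm z" "\<And>z. isCont fp z"
    and \<sigma>: "\<sigma> = (\<lambda>x. sgn ((x - x0) \<bullet> w))"
    and half: "\<And>v. v \<in> filippov_field fm fp \<sigma> z \<Longrightarrow> a \<bullet> v < b"
  shows "\<exists>d>0. \<forall>y\<in>ball z d. \<forall>v\<in>filippov_field fm fp \<sigma> y. a \<bullet> v \<le> b"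
proof -
  have sg: "\<sigma> y < 0 \<longleftrightarrow> (y - x0) \<bullet> w < 0" "\<sigma> y > 0 \<longleftrightarrow> (y - x0) \<bullet> w > 0" for y
    by (simp_all add: \<sigma> sgn_less sgn_greater)
  have near: "\<exists>d>0. \<forall>y\<in>ball z d. c * ((y - x0) \<bullet> w) < 0" if "c * ((z - x0) \<bullet> w) < 0" for c :: real
  proof -
    have "isCont (\<lambda>y. c * ((y - x0) \<bullet> w)) z" by (intro continuous_intros)
    from halfspace_upper_semicontinuous[OF this, of 1 0] that show ?thesis by simp
  qed
  consider "\<sigma> z < 0" | "\<sigma> z > 0" | "\<not> \<sigma> z < 0" "\<not> \<sigma> z > 0" by blast
  then show ?thesis
  proof cases
    case 1
    then have "a \<bullet> fm z < b" by (intro half) (simp add: filippov_field_eq)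
    then obtain d1 where d1: "d1 > 0" "\<forall>y\<in>ball z d1. a \<bullet> fm y < b"
      using halfspace_upper_semicontinuous[OF cont(1)] by blast
    obtain d2 where d2: "d2 > 0" "\<forall>y\<in>ball z d2. 1 * ((y - x0) \<bullet> w) < 0"
      using near[of 1] 1 sg by auto
    show ?thesis
    proof (intro exI[of _ "min d1 d2"] conjI ballI)
      fix y v assume y: "y \<in> ball z (min d1 d2)" "v \<in> filippov_field fm fp \<sigma> y"
      then have "\<sigma> y < 0" using d2 sg by auto
      then show "a \<bullet> v \<le> b" using y d1 by (auto simp: filippov_field_eq less_imp_le)
    qed (use d1 d2 in auto)
  next
    case 2
    then have "a \<bullet> fp z < b" by (intro half) (simp add: filippov_field_eq)
    then obtain d1 where d1: "d1 > 0" "\<forall>y\<in>ball z d1. a \<bullet> fp y < b"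
      using halfspace_upper_semicontinuous[OF cont(2)] by blast
    obtain d2 where d2: "d2 > 0" "\<forall>y\<in>ball z d2. (- 1) * ((y - x0) \<bullet> w) < 0"
      using near[of "- 1"] 2 sg by auto
    show ?thesis
    proof (intro exI[of _ "min d1 d2"] conjI ballI)
      fix y v assume y: "y \<in> ball z (min d1 d2)" "v \<in> filippov_field fm fp \<sigma> y"
      then have "\<sigma> y > 0" using d2 sg by auto
      then show "a \<bullet> v \<le> b" using y d1 by (auto simp: filippov_field_eq less_imp_le)
    qed (use d1 d2 in auto)
  next
    case 3
    then have "a \<bullet> fm z < b" "a \<bullet> fp z < b" by (auto intro!: half simp: filippov_field_eq)
    then obtain d1 d2 where d: "d1 > 0" "\<forall>y\<in>ball z d1. a \<bullet> fm y < b" "d2 > 0" "\<forall>y\<in>ball z d2. a \<bullet> fp y < b"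
      using halfspace_upper_semicontinuous cont by metis
    show ?thesis
    proof (intro exI[of _ "min d1 d2"] conjI ballI)
      fix y v assume y: "y \<in> ball z (min d1 d2)" "v \<in> filippov_field fm fp \<sigma> y"
      then have "v \<in> closed_segment (fp y) (fm y)" using filippov_field_subset_segment by blast
      then show "a \<bullet> v \<le> b" by (rule segment_halfspace[rotated 2]) (use y d in \<open>auto simp: less_imp_le\<close>)
    qed (use d in auto)
  qed
qed

lemma filippov_field_locally_bounded:
  fixes fm fp :: "real^'n \<Rightarrow> real^'n"
  assumes cont: "\<And>z. isCont fm z" "\<And>z. isCont fp z"
  shows "\<exists>M. \<forall>z\<in>cball x0 R. \<forall>v\<in>filippov_field fm fp \<sigma> z. norm v \<le> M"
proof -
  have "\<exists>M. \<forall>z\<in>cball x0 R. norm (f z) \<le> M" if "\<And>z. isCont f z" for f :: "real^'n \<Rightarrow> real^'n"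
  proof -
    have "bounded (f ` cball x0 R)"
      using that by (intro compact_imp_bounded compact_continuous_image continuous_at_imp_continuous_on) auto
    then show ?thesis by (auto simp: bounded_iff)
  qed
  then obtain M1 M2 where M: "\<And>z. z \<in> cball x0 R \<Longrightarrow> norm (fm z) \<le> M1" "\<And>z. z \<in> cball x0 R \<Longrightarrow> norm (fp z) \<le> M2"
    using cont by metis
  have "norm v \<le> max M1 M2" if "z \<in> cball x0 R" "v \<in> filippov_field fm fp \<sigma> z" for z v
  proof -
    have "closed_segment (fp z) (fm z) \<subseteq> cball 0 (max M1 M2)"
      by (rule closed_segment_subset) (use M[OF that(1)] in auto)
    then show ?thesis using that(2) filippov_field_subset_segment by (fastforce simp: subset_iff)
  qed
  then show ?thesis by blast
qed

section \<open>Stability of the switched system\<close>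

theorem theorem3p1:
  fixes fm fp :: "real^'n \<Rightarrow> real^'n"
    and x0 :: "real^'n"
    and V :: "real^'n \<Rightarrow> real"
    and P :: "real^'n^'n"
    and \<alpha> :: real
    and \<sigma> :: "real^'n \<Rightarrow> real"
  assumes "C1 fm" and "C1 fp"
    and "switched_equilibrium fm fp x0"
    and nondegenerate: "fm x0 = 0 \<Longrightarrow> fp x0 = 0"
    and "C2 V"
    and "V = quadratic_at x0 P"
    and "sym_pos_def P"
    and "\<alpha> > 0"
    and "\<And>x. frechet_derivative V (at x) (fm x - fm x0) \<le> - \<alpha> * (norm (x - x0))\<^sup>2"
    and "\<And>x. frechet_derivative V (at x) (fp x - fp x0) \<le> - \<alpha> * (norm (x - x0))\<^sup>2"
    and "\<sigma> = (\<lambda>x. sgn ((x - x0) \<bullet> (hessian V x0 *v fm x0)))"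
  shows "quadratically_globally_stable (filippov_field fm fp \<sigma>) x0"
proof -
  have sym: "transpose P = P" using \<open>sym_pos_def P\<close> by (simp add: sym_pos_def_def)
  define h where "h x = 2 * ((x - x0) \<bullet> (P *v fm x0))" for x
  have \<sigma>: "\<sigma> = (\<lambda>x. sgn ((x - x0) \<bullet> (2 *\<^sub>R (P *v fm x0))))"
    using assms(11) \<open>V = quadratic_at x0 P\<close> hessian_quadratic_at[OF sym, of x0 x0]
    by (simp add: scaleR_matrix_vector_assoc[symmetric])
  have \<sigma>h: "\<sigma> x = sgn (h x)" for x by (simp add: \<sigma> h_def)
  have cont: "isCont fm z" "isCont fp z" for z using assms(1,2) C1_imp_continuous by auto
  obtain l where l: "l \<in> {0..1}" "l *\<^sub>R fm x0 + (1 - l) *\<^sub>R fp x0 = 0"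
    using \<open>switched_equilibrium fm fp x0\<close> by (auto simp: switched_equilibrium_def)
  \<comment> \<open>For \<open>l < 1\<close> the equilibrium condition can be solved for \<open>fp x0\<close>. For \<open>l = 1\<close> it says
    nothing about \<open>fp x0\<close>, and \<open>nondegenerate\<close> takes its place.\<close>
  obtain k where k: "k \<ge> 0" "fp x0 = - k *\<^sub>R fm x0"
  proof (cases "l = 1")
    case True
    then have "fm x0 = 0" using l(2) by simp
    then have "fp x0 = - 0 *\<^sub>R fm x0" using nondegenerate by simp
    then show ?thesis using that by blast
  next
    case False
    then have l1: "1 - l > 0" using l(1) by simp
    have "(1 - l) *\<^sub>R fp x0 = - l *\<^sub>R fm x0" using l(2) by (simp add: eq_neg_iff_add_eq_0 add.commute)
    then have "(1 / (1 - l)) *\<^sub>R (1 - l) *\<^sub>R fp x0 = (1 / (1 - l)) *\<^sub>R (- l) *\<^sub>R fm x0" by simp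
    then have "fp x0 = - (l / (1 - l)) *\<^sub>R fm x0" using l1 by simp
    then show ?thesis using that[of "l / (1 - l)"] l1 l(1) by simp
  qed
  have dm: "2 * ((z - x0) \<bullet> (P *v fm z)) \<le> - \<alpha> * (norm (z - x0))\<^sup>2 + h z" for z
    using assms(9)[of z] unfolding \<open>V = quadratic_at x0 P\<close> frechet_derivative_quadratic_at[OF sym] h_def
    by (simp add: matrix_vector_mult_diff_distrib inner_diff_right)
  have dp: "2 * ((z - x0) \<bullet> (P *v fp z)) \<le> - \<alpha> * (norm (z - x0))\<^sup>2 - k * h z" for z
    using assms(10)[of z] unfolding \<open>V = quadratic_at x0 P\<close> frechet_derivative_quadratic_at[OF sym] h_def k(2)
    by (simp add: matrix_vector_right_distrib inner_add_right matrix_vector_mult_scaleR algebra_simps)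
  have "dissipative_inclusion (filippov_field fm fp \<sigma>) x0 P \<alpha>"
  proof
    fix z v a :: "real^'n" and b R :: real
    show "filippov_field fm fp \<sigma> z \<noteq> {}" "closed (filippov_field fm fp \<sigma> z)" "convex (filippov_field fm fp \<sigma> z)"
      by (auto simp: filippov_field_eq)
    show "\<exists>M. \<forall>z\<in>cball x0 R. \<forall>v\<in>filippov_field fm fp \<sigma> z. norm v \<le> M"
      using cont by (rule filippov_field_locally_bounded)
    show "\<exists>d>0. \<forall>w\<in>ball z d. \<forall>v\<in>filippov_field fm fp \<sigma> w. a \<bullet> v \<le> b"
      if "\<And>v. v \<in> filippov_field fm fp \<sigma> z \<Longrightarrow> a \<bullet> v < b"
      using filippov_field_usc[OF cont \<sigma> that] .
    assume v: "v \<in> filippov_field fm fp \<sigma> z"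
    show "2 * ((z - x0) \<bullet> (P *v v)) \<le> - \<alpha> * (norm (z - x0))\<^sup>2"
    proof -
      consider "h z < 0" | "h z > 0" | "h z = 0" by linarith
      then show ?thesis
      proof cases
        case 1
        then have "v = fm z" using v by (simp add: filippov_field_eq \<sigma>h)
        then show ?thesis using dm[of z] 1 by simp
      next
        case 2
        then have "v = fp z" using v by (simp add: filippov_field_eq \<sigma>h)
        then show ?thesis using dp[of z] 2 k(1) by (smt (verit) mult_nonneg_nonneg)
      next
        case 3
        define a where "a = 2 *\<^sub>R (P *v (z - x0))"
        have a: "2 * ((z - x0) \<bullet> (P *v u)) = a \<bullet> u" for u
          using symmetric_inner_commute[OF sym, of "z - x0" u] by (simp add: a_def inner_commute)
        have "v \<in> closed_segment (fp z) (fm z)" using v filippov_field_subset_segment by blast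
        moreover have "a \<bullet> fp z \<le> - \<alpha> * (norm (z - x0))\<^sup>2" "a \<bullet> fm z \<le> - \<alpha> * (norm (z - x0))\<^sup>2"
          using dp[of z] dm[of z] 3 by (simp_all add: a)
        ultimately show ?thesis unfolding a by (intro segment_halfspace[of a "fp z" _ "fm z" v])
      qed
    qed
  qed (fact assms)+
  moreover have "0 \<in> filippov_field fm fp \<sigma> x0"
    using l by (auto simp: filippov_field_def \<sigma> intro!: exI[of _ l])
  ultimately show ?thesis by (rule dissipative_inclusion.quadratic_Lyapunov_stability)
qed

end
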